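(* If $G$ is a planar graph with girth at least $6$, then $G$ has an equitable $t$-tree-coloring for every integer $t\ge 2$; that is, $va^{\equiv}_{\infty,\infty}(G)=2$ if $G$ is not a forest and $va^{\equiv}_{\infty,\infty}(G)=1$ otherwise.
   Context: The girth of a graph is the length of a shortest cycle (infinite for forests). A $t$-coloring of $G$ is a map $f:V(G)\to\{1,\dots,t\}$ (not necessarily surjective) with color classes $V_i=f^{-1}(i)$; it is equitable if $||V_i|-|V_j||\le 1$ for all $i,j$. An equitable $t$-tree-coloring is an equitable $t$-coloring in which every color class induces a forest. $va^{\equiv}_{\infty,\infty}(G)$ is the smallest positive integer $t$ such that $G$ has an equitable $t'$-tree-coloring for every integer $t'\ge t$. *)

theory Defs
  imports "HOL-Analysis.Analysis" "HOL-Library.Extended_Nat" "Graph_Theory.Graph_Theory"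
begin

text \<open>
  A finite simple undirected graph is a symmetric digraph without loops and parallel arcs
  (locale \<^locale>\<open>graph\<close>): each edge is represented by its two antiparallel arcs. In this
  representation \<^const>\<open>pre_digraph.cycle\<close> also accepts the closed walk \<open>u, v, u\<close>, which is not a
  cycle of the undirected graph, so \<^const>\<open>forest\<close> cannot be used; the length bound excludes
  exactly these walks.
\<close>

definition ucycle :: "('a, 'b) pre_digraph \<Rightarrow> 'b awalk \<Rightarrow> bool" where
  "ucycle G p \<longleftrightarrow> pre_digraph.cycle G p \<and> 3 \<le> length p"

definition uforest :: "('a, 'b) pre_digraph \<Rightarrow> bool" where
  "uforest G \<longleftrightarrow> (\<nexists>p. ucycle G p)"

definition girth :: "('a, 'b) pre_digraph \<Rightarrow> enat" where
  "girth G = (INF p\<in>{p. ucycle G p}. enat (length p))"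

definition uedges :: "('a, 'b) pre_digraph \<Rightarrow> 'a set set" where
  "uedges G = (\<lambda>e. {tail G e, head G e}) ` arcs G"

text \<open>
  A drawing without crossings: distinct vertices are distinct points, an edge is a simple arc
  joining its two ends, and the interior of an edge contains no vertex and no point of any other
  edge. The plane is the type \<^typ>\<open>complex\<close>.
\<close>

definition plane_drawing ::
    "('a, 'b) pre_digraph \<Rightarrow> ('a \<Rightarrow> complex) \<Rightarrow> ('a set \<Rightarrow> real \<Rightarrow> complex) \<Rightarrow> bool" where
  "plane_drawing G pos \<gamma> \<longleftrightarrow>
     inj_on pos (verts G) \<and>
     (\<forall>e\<in>uedges G. arc (\<gamma> e) \<and> {pathstart (\<gamma> e), pathfinish (\<gamma> e)} = pos ` e) \<and>
     (\<forall>e\<in>uedges G. (path_image (\<gamma> e) - pos ` e) \<inter>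
        (pos ` verts G \<union> (\<Union>e'\<in>uedges G - {e}. path_image (\<gamma> e'))) = {})"

definition planar :: "('a, 'b) pre_digraph \<Rightarrow> bool" where
  "planar G \<longleftrightarrow> (\<exists>pos \<gamma>. plane_drawing G pos \<gamma>)"

definition color_class :: "('a, 'b) pre_digraph \<Rightarrow> ('a \<Rightarrow> nat) \<Rightarrow> nat \<Rightarrow> 'a set" where
  "color_class G f i = {v \<in> verts G. f v = i}"

definition coloring :: "('a, 'b) pre_digraph \<Rightarrow> nat \<Rightarrow> ('a \<Rightarrow> nat) \<Rightarrow> bool" where
  "coloring G t f \<longleftrightarrow> f ` verts G \<subseteq> {1..t}"

definition equitable_coloring :: "('a, 'b) pre_digraph \<Rightarrow> nat \<Rightarrow> ('a \<Rightarrow> nat) \<Rightarrow> bool" where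
  "equitable_coloring G t f \<longleftrightarrow> coloring G t f \<and>
     (\<forall>i\<in>{1..t}. \<forall>j\<in>{1..t}.
        \<bar>int (card (color_class G f i)) - int (card (color_class G f j))\<bar> \<le> 1)"

definition equitable_tree_coloring :: "('a, 'b) pre_digraph \<Rightarrow> nat \<Rightarrow> ('a \<Rightarrow> nat) \<Rightarrow> bool" where
  "equitable_tree_coloring G t f \<longleftrightarrow> equitable_coloring G t f \<and>
     (\<forall>i\<in>{1..t}. uforest (G \<restriction> color_class G f i))"

definition va_equiv :: "('a, 'b) pre_digraph \<Rightarrow> nat" where
  "va_equiv G = (LEAST t. 1 \<le> t \<and> (\<forall>t'\<ge>t. \<exists>f. equitable_tree_coloring G t' f))"

end

theory Submission
  imports Defs
begin

text \<open>
  A drawing of a graph of girth at least 6 has at least \<open>m - n + 2\<close> faces, every face has at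
  least 6 edges on its frontier (the graph having no bridges), and every edge is on the frontier of
  at most two faces. Hence all subgraphs satisfy \<open>2 m < 3 n\<close>. This sparsity is all that is used
  of planarity: by discharging, there is a vertex of degree at most 1, or a vertex of degree 2 next
  to one of degree at most 4, or a vertex of degree 5 all of whose neighbours have degree 2. Each of
  them can be completed to a set \<open>S\<close> whose size is a multiple of \<open>t\<close> such that every equitable tree
  colouring of the graph without \<open>S\<close> extends, each colour being used equally often on \<open>S\<close>.
\<close>

subsection \<open>Acyclic edge sets\<close>

text \<open>Counting works with edge sets instead of Euler's formula. In a nonempty bridgeless set
  of m edges with a spanning forest \<open>T\<close>, each of the m - |T| other edges closes a cycle
  and so adds a face. There are thus more than m - |T| faces, but at most m/3, whence 2 m < 3 |T|,
  and |T| is less than the number of vertices. Bridges need separate treatment because the bound of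
  two faces per edge rests on a cycle through the edge. They cost nothing: putting a bridge back
  increases both m and |T| by one, so 2 m \<le> 3 |T| survives. Girth enters only as the condition
  that every non-acyclic edge set has at least 6 elements, which passes to subsets.

  For the colouring, the obstacle is that no class may gain more vertices than another. If
  \<open>S\<close> has t vertices and they all get different colours, no edge inside
  \<open>S\<close> lies in a colour class, and each vertex only needs a colour that occurs at most
  once among its neighbours outside \<open>S\<close>. A greedy choice achieves this in all cases but
  one: two colours and a vertex of degree 5. There \<open>S\<close> has six vertices and the
  colouring is explicit.\<close>

definition uconn :: "'a set set \<Rightarrow> 'a \<Rightarrow> 'a \<Rightarrow> bool" where
  "uconn E = (\<lambda>x y. {x, y} \<in> E)\<^sup>*\<^sup>*"

text \<open>Every edge is a bridge. This form mentions no cycles and suits inductions that add one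
  edge at a time. A loop \<open>{u, u}\<close> violates it because \<open>uconn\<close> is
  reflexive.\<close>

definition edge_acyclic :: "'a set set \<Rightarrow> bool" where
  "edge_acyclic E \<longleftrightarrow> (\<forall>u v. {u, v} \<in> E \<longrightarrow> \<not> uconn (E - {{u, v}}) u v)"

lemma uconn_refl [simp]: "uconn E u u"
  by (simp add: uconn_def)

lemma uconn_edge: "{u, v} \<in> E \<Longrightarrow> uconn E u v"
  by (simp add: uconn_def r_into_rtranclp)

lemma uconn_trans: "uconn E u v \<Longrightarrow> uconn E v w \<Longrightarrow> uconn E u w"
  by (simp add: uconn_def)

lemma uconn_mono: "uconn E u v \<Longrightarrow> E \<subseteq> F \<Longrightarrow> uconn F u v"
  unfolding uconn_def by (erule rtranclp_mono[THEN predicate2D, rotated]) auto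

lemma uconn_sym: "uconn E u v \<Longrightarrow> uconn E v u"
  unfolding uconn_def
  by (rule sympD[OF sympI[OF sympD[OF symp_rtranclp]]])
     (auto intro!: sympI simp: insert_commute)

text \<open>A walk that uses the new edge several times can be shortened until it uses it at most
  once, in one of the two directions.\<close>

lemma uconn_insertD:
  assumes "uconn (insert {u, v} E) x y"
  shows "uconn E x y \<or> uconn E x u \<and> uconn E v y \<or> uconn E x v \<and> uconn E u y"
  using assms unfolding uconn_def
proof (induction rule: rtranclp_induct)
  case base
  then show ?case by simp
next
  case (step y z)
  have "{y, z} = {u, v} \<or> uconn E y z"
    using step.hyps(2) uconn_edge[of y z E] by (metis insertE)
  then consider "y = u" "z = v" | "y = v" "z = u" | "uconn E y z"
    by (metis doubleton_eq_iff)
  then show ?case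
    using step.IH[folded uconn_def] by (cases; unfold uconn_def[symmetric]) (metis uconn_refl uconn_trans)+
qed

lemma edge_acyclic_empty [simp]: "edge_acyclic {}"
  by (simp add: edge_acyclic_def)

lemma edge_acyclic_subset: "edge_acyclic E \<Longrightarrow> F \<subseteq> E \<Longrightarrow> edge_acyclic F"
  unfolding edge_acyclic_def by (meson Diff_mono subsetD subset_refl uconn_mono)

text \<open>If an old edge \<open>{x, y}\<close> ceased to be a bridge, the detour around it would
  pass through \<open>{u, v}\<close>; its two remaining pieces together with \<open>{x, y}\<close>
  would then join \<open>u\<close> to \<open>v\<close> inside \<open>E\<close>.\<close>

lemma edge_acyclic_insert:
  assumes "edge_acyclic E" "\<not> uconn E u v"
  shows "edge_acyclic (insert {u, v} E)"
  unfolding edge_acyclic_def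
proof (intro allI impI notI)
  fix x y assume xy: "{x, y} \<in> insert {u, v} E" and c: "uconn (insert {u, v} E - {{x, y}}) x y"
  have uv: "{u, v} \<notin> E"
    using assms(2) uconn_edge[of u v E] by metis
  show False
  proof (cases "{x, y} = {u, v}")
    case True
    then have "uconn E x y"
      using c uv by (metis Diff_insert_absorb)
    then show False
      using True assms(2) uconn_sym[of E x y] by (metis doubleton_eq_iff)
  next
    case False
    then have xyE: "{x, y} \<in> E"
      using xy by blast
    let ?S = "E - {{x, y}}"
    have "uconn (insert {u, v} ?S) x y"
      using c by (rule uconn_mono) auto
    moreover have "\<not> uconn ?S x y"
      using assms(1) xyE by (simp add: edge_acyclic_def)
    ultimately consider "uconn ?S x u" "uconn ?S v y" | "uconn ?S x v" "uconn ?S u y"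
      using uconn_insertD by metis
    then have "uconn E u v"
      by cases (meson Diff_subset uconn_edge uconn_mono uconn_sym uconn_trans xyE)+
    then show False
      using assms(2) by simp
  qed
qed

lemma edge_acyclic_card_less:
  assumes "finite E" "edge_acyclic E" "\<And>e. e \<in> E \<Longrightarrow> card e = 2" "finite V" "V \<noteq> {}" "\<Union>E \<subseteq> V"
  shows "card E < card V"
proof -
  \<comment> \<open>\<open>R\<close> meets every component. A new edge merges two components, with
    representatives \<open>a\<close> and \<open>b\<close>, and \<open>a\<close> is dropped; so
    \<open>card R + card E\<close> stays constant.\<close>
  have "\<exists>R\<subseteq>V. R \<noteq> {} \<and> card R + card E = card V \<and> (\<forall>v\<in>V. \<exists>r\<in>R. uconn E v r)"
    using assms(1,2,3,6)
  proof (induction rule: finite_induct)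
    case empty
    then show ?case using assms(5) by (intro exI[of _ V]) (auto intro: uconn_refl)
  next
    case (insert e E)
    obtain u v where e: "e = {u, v}" "u \<noteq> v"
      using insert.prems(2)[of e] by (auto simp: card_2_iff)
    have nc: "\<not> uconn E u v"
      using insert.prems(1) insert.hyps(2) by (auto simp: edge_acyclic_def e insert_Diff_if)
    have "edge_acyclic E"
      using insert.prems(1) by (rule edge_acyclic_subset) auto
    then obtain R where R: "R \<subseteq> V" "R \<noteq> {}" "card R + card E = card V"
      "\<And>w. w \<in> V \<Longrightarrow> \<exists>r\<in>R. uconn E w r"
      using insert.IH insert.prems(2,3) by (metis Union_insert insertI2 le_sup_iff)
    obtain a b where ab: "a \<in> R" "b \<in> R" "uconn E u a" "uconn E v b"
      using R(4) insert.prems(3) e by (metis Union_upper insertCI insert_subset subset_iff)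
    have "a \<noteq> b"
      using nc ab uconn_trans uconn_sym by metis
    have fR: "finite R"
      using R(1) assms(4) finite_subset by blast
    have "\<exists>r\<in>R - {a}. uconn (insert e E) w r" if w: "w \<in> V" for w
    proof -
      obtain r where r: "r \<in> R" "uconn E w r"
        using R(4) w by blast
      show ?thesis
      proof (cases "r = a")
        case True
        have "uconn (insert e E) w u"
          using r True ab(3) uconn_trans uconn_sym uconn_mono by (metis subset_insertI)
        moreover have "uconn (insert e E) u v"
          by (rule uconn_edge) (simp add: e)
        moreover have "uconn (insert e E) v b"
          using ab(4) by (rule uconn_mono) auto
        ultimately show ?thesis
          using ab \<open>a \<noteq> b\<close> uconn_trans by (metis insert_Diff insert_iff)
      next
        case False
        then show ?thesis
          using r uconn_mono by (metis Diff_iff singletonD subset_insertI)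
      qed
    qed
    moreover have "card (R - {a}) + card (insert e E) = card V"
      using R(3) ab(1) fR insert.hyps
      by (simp add: card_Diff_singleton) (metis card_gt_0_iff Suc_pred add_Suc_right add_Suc empty_iff)
    moreover have "R - {a} \<noteq> {}"
      using ab \<open>a \<noteq> b\<close> by blast
    ultimately show ?case
      using R(1) by (intro exI[of _ "R - {a}"]) auto
  qed
  then obtain R where "R \<subseteq> V" "R \<noteq> {}" "card R + card E = card V"
    by blast
  moreover have "card R > 0"
    using calculation assms(4) by (simp add: card_gt_0_iff finite_subset)
  ultimately show ?thesis
    by linarith
qed

text \<open>Greedy choice: an edge enters \<open>T\<close> exactly when \<open>T\<close> does not
  yet connect its ends.\<close>

lemma edge_acyclic_spanning:
  assumes "finite E" "\<And>e. e \<in> E \<Longrightarrow> card e = 2"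
  obtains T where "T \<subseteq> E" "edge_acyclic T" "\<And>u v. {u, v} \<in> E \<Longrightarrow> uconn T u v"
proof -
  have "\<exists>T\<subseteq>E. edge_acyclic T \<and> (\<forall>u v. {u, v} \<in> E \<longrightarrow> uconn T u v)"
    using assms
  proof (induction rule: finite_induct)
    case empty
    then show ?case by auto
  next
    case (insert e E)
    then obtain T where T: "T \<subseteq> E" "edge_acyclic T" "\<And>u v. {u, v} \<in> E \<Longrightarrow> uconn T u v"
      by auto
    obtain u v where e: "e = {u, v}" "u \<noteq> v"
      using insert.prems[of e] by (auto simp: card_2_iff)
    show ?case
    proof (cases "uconn T u v")
      case True
      then show ?thesis
        using T e uconn_sym[OF True] by (intro exI[of _ T]) (auto simp: doubleton_eq_iff)
    next
      case False
      have "uconn (insert e T) x y" if "{x, y} \<in> insert e E" for x y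
        using that T(3) uconn_edge[of x y "insert e T"] uconn_mono[of T x y "insert e T"] by blast
      then show ?thesis
        using T edge_acyclic_insert[OF T(2) False] e by (intro exI[of _ "insert e T"]) auto
    qed
  qed
  then show ?thesis
    using that by blast
qed

section \<open>Paths as lists of distinct vertices\<close>

fun path_edges :: "'a list \<Rightarrow> 'a set set" where
  "path_edges (x # y # zs) = insert {x, y} (path_edges (y # zs))"
| "path_edges _ = {}"

lemma Union_path_edges: "\<Union>(path_edges xs) \<subseteq> set xs"
  by (induction xs rule: path_edges.induct) auto

lemma card_path_edges: "distinct xs \<Longrightarrow> finite (path_edges xs) \<and> card (path_edges xs) = length xs - 1"
proof (induction xs rule: path_edges.induct)
  case (1 x y zs)
  moreover have "{x, y} \<notin> path_edges (y # zs)"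
    using 1(2) Union_path_edges[of "y # zs"] by auto
  ultimately show ?case by simp
qed auto

lemma uconn_imp_distinct_path:
  assumes "uconn E u v"
  obtains xs where "xs \<noteq> []" "hd xs = u" "last xs = v" "distinct xs" "path_edges xs \<subseteq> E"
proof -
  have "\<exists>xs. xs \<noteq> [] \<and> hd xs = u \<and> last xs = v \<and> distinct xs \<and> path_edges xs \<subseteq> E"
    using assms unfolding uconn_def
  proof (induction rule: converse_rtranclp_induct)
    case base
    then show ?case by (intro exI[of _ "[v]"]) auto
  next
    case (step x y)
    then obtain xs where xs: "xs \<noteq> []" "hd xs = y" "last xs = v" "distinct xs" "path_edges xs \<subseteq> E"
      by blast
    show ?case
    proof (cases "x \<in> set xs")
      case False
      then show ?thesis
        using xs step.hyps(1) by (intro exI[of _ "x # xs"]) (cases xs; auto)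
    next
      case True
      \<comment> \<open>Prepending \<open>x\<close> would repeat it, so the path is cut and starts
        at the earlier occurrence of \<open>x\<close>.\<close>
      then obtain ys zs where "xs = ys @ x # zs"
        by (meson split_list)
      moreover have "path_edges zs' \<subseteq> path_edges (ys @ zs')" for zs'
      proof (induction ys)
        case (Cons a ys)
        then show ?case by (cases "ys @ zs'") auto
      qed simp
      ultimately show ?thesis
        using xs by (intro exI[of _ "x # zs"]) auto
    qed
  qed
  then show ?thesis
    using that by blast
qed

lemma uconn_path_edges: "xs \<noteq> [] \<Longrightarrow> path_edges xs \<subseteq> E \<Longrightarrow> uconn E (hd xs) (last xs)"
proof (induction xs rule: path_edges.induct)
  case (1 x y zs)
  then have "uconn E x y" "uconn E y (last (y # zs))"
    by (auto intro: uconn_edge)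
  then show ?case
    using uconn_trans by fastforce
qed auto

text \<open>The length bound excludes \<open>[x, y]\<close>, whose only edge is the closing one: the
  walk forth and back along an edge.\<close>

lemma closing_edge_notin_path_edges:
  assumes "distinct xs" "3 \<le> length xs"
  shows "{hd xs, last xs} \<notin> path_edges xs"
proof -
  obtain x y zs where xs: "xs = x # y # zs" "zs \<noteq> []"
    using assms(2) by (cases xs; cases "tl xs"; cases "tl (tl xs)") auto
  have "last zs \<noteq> y"
    using assms(1) xs last_in_set by fastforce
  then have "{x, last zs} \<noteq> {x, y}"
    by (auto simp: doubleton_eq_iff)
  moreover have "{x, last zs} \<notin> path_edges (y # zs)"
    using assms(1) xs Union_path_edges[of "y # zs"] by auto
  ultimately show ?thesis
    using xs by simp
qed

subsection \<open>Plane drawings\<close>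

text \<open>Invariance of dimension: an arc is homeomorphic to an interval, and a nonempty open set
  of the plane has no continuous injection into the line. Thanks to this, points off the drawing can
  be chosen in any nonempty open set.\<close>

lemma interior_arc_empty:
  fixes g :: "real \<Rightarrow> complex"
  assumes "arc g"
  shows "interior (path_image g) = {}"
proof (rule ccontr)
  assume ne: "interior (path_image g) \<noteq> {}"
  have "path_image g homeomorphic {0..1::real}"
    by (simp add: assms homeomorphic_arc_image_interval)
  then obtain f k where "homeomorphism (path_image g) {0..1::real} f k"
    by (auto simp: homeomorphic_def)
  then have "continuous_on (path_image g) f" "inj_on f (path_image g)"
    by (auto simp: homeomorphism_def inj_on_def) metis
  then have "DIM(complex) \<le> DIM(real)"
    using ne by (intro invariance_of_dimension[of "interior (path_image g)" f])
      (auto intro: continuous_on_subset[OF _ interior_subset] inj_on_subset[OF _ interior_subset])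
  then show False
    by simp
qed

text \<open>Only edges and their ends are drawn, so the notion passes to every subset of the edges.
  Used for both orders of two edges and with \<open>inj_pos\<close>, \<open>edge_Int\<close>
  confines their intersection to common ends.\<close>

locale plane_edges =
  fixes E :: "'a set set" and pos :: "'a \<Rightarrow> complex" and \<gamma> :: "'a set \<Rightarrow> real \<Rightarrow> complex"
  assumes finite_edges: "finite E"
    and card_edge: "e \<in> E \<Longrightarrow> card e = 2"
    and inj_pos: "inj_on pos (\<Union>E)"
    and arc_edge: "e \<in> E \<Longrightarrow> arc (\<gamma> e)"
    and edge_ends: "e \<in> E \<Longrightarrow> {pathstart (\<gamma> e), pathfinish (\<gamma> e)} = pos ` e"
    and edge_Int: "e \<in> E \<Longrightarrow> e' \<in> E \<Longrightarrow> e \<noteq> e' \<Longrightarrow>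
      path_image (\<gamma> e) \<inter> path_image (\<gamma> e') \<subseteq> pos ` e"
begin

lemma plane_edges_subset: "F \<subseteq> E \<Longrightarrow> plane_edges F pos \<gamma>"
  by unfold_locales
    (auto simp: card_edge arc_edge edge_ends subsetD dest: edge_Int
      intro: finite_subset[OF _ finite_edges] inj_on_subset[OF inj_pos])

section \<open>Point sets of partial drawings\<close>

definition drawn :: "'a set set \<Rightarrow> complex set" where
  "drawn F = (\<Union>e\<in>F. path_image (\<gamma> e))"

definition open_edge :: "'a set \<Rightarrow> complex set" where
  "open_edge e = path_image (\<gamma> e) - pos ` e"

lemma drawn_mono: "A \<subseteq> B \<Longrightarrow> drawn A \<subseteq> drawn B"
  by (auto simp: drawn_def)

lemma drawn_Un: "drawn (A \<union> B) = drawn A \<union> drawn B"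
  by (auto simp: drawn_def)

lemma drawn_insert: "drawn (insert e B) = path_image (\<gamma> e) \<union> drawn B"
  by (auto simp: drawn_def)

lemma drawn_empty [simp]: "drawn {} = {}"
  by (simp add: drawn_def)

lemma compact_drawn: "F \<subseteq> E \<Longrightarrow> compact (drawn F)"
  unfolding drawn_def
  by (intro compact_UN) (auto intro: compact_path_image arc_imp_path arc_edge finite_subset[OF _ finite_edges])

lemma closed_drawn: "F \<subseteq> E \<Longrightarrow> closed (drawn F)"
  by (simp add: compact_drawn compact_imp_closed)

lemma pos_in_edge: "e \<in> E \<Longrightarrow> x \<in> e \<Longrightarrow> pos x \<in> path_image (\<gamma> e)"
  using edge_ends[of e] by (metis imageI insertE pathfinish_in_path_image pathstart_in_path_image singletonD)

lemma drawn_Int: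
  assumes "A \<subseteq> E" "B \<subseteq> E" "A \<inter> B = {}"
  shows "drawn A \<inter> drawn B \<subseteq> pos ` (\<Union>A \<inter> \<Union>B)"
proof
  fix z assume "z \<in> drawn A \<inter> drawn B"
  then obtain a b where ab: "a \<in> A" "b \<in> B" "z \<in> path_image (\<gamma> a)" "z \<in> path_image (\<gamma> b)"
    by (auto simp: drawn_def)
  then have "a \<noteq> b" "a \<in> E" "b \<in> E"
    using assms by auto
  then have "z \<in> pos ` a" "z \<in> pos ` b"
    using edge_Int[of a b] edge_Int[of b a] ab by auto
  then obtain x y where xy: "x \<in> a" "y \<in> b" "z = pos x" "z = pos y"
    by auto
  then have "x = y"
    using inj_pos \<open>a \<in> E\<close> \<open>b \<in> E\<close> by (auto simp: inj_on_def)
  then show "z \<in> pos ` (\<Union>A \<inter> \<Union>B)"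
    using xy ab by auto
qed

lemma open_edge_notin_drawn:
  assumes "e \<in> E" "F \<subseteq> E" "e \<notin> F"
  shows "open_edge e \<inter> drawn F = {}"
  using drawn_Int[of "{e}" F] assms by (auto simp: open_edge_def drawn_insert)

lemma open_edge_image:
  assumes "e \<in> E"
  shows "open_edge e = \<gamma> e ` {0<..<1}"
proof -
  have inj: "inj_on (\<gamma> e) {0..1}"
    using arc_edge[OF assms] by (simp add: arc_def)
  have "open_edge e = \<gamma> e ` {0..1} - \<gamma> e ` {0, 1}"
    using edge_ends[OF assms] by (auto simp: open_edge_def path_image_def pathstart_def pathfinish_def)
  also have "\<dots> = \<gamma> e ` ({0..1} - {0, 1})"
    using inj by (simp add: inj_on_image_set_diff)
  also have "{0..1} - {0, 1} = {0<..<1::real}"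
    by auto
  finally show ?thesis .
qed

lemma open_edge_nonempty: "e \<in> E \<Longrightarrow> open_edge e \<noteq> {}"
  by (simp add: open_edge_image)

lemma connected_open_edge: "e \<in> E \<Longrightarrow> topological_space_class.connected (open_edge e)"
  using arc_edge[of e]
  by (auto simp: open_edge_image arc_def path_def intro!: connected_continuous_image
      elim!: continuous_on_subset)

lemma interior_drawn:
  assumes "F \<subseteq> E"
  shows "interior (drawn F) = {}"
proof -
  have "finite F"
    using assms finite_edges finite_subset by blast
  then show ?thesis
    using assms
  proof (induction rule: finite_induct)
    case (insert e F)
    then show ?case
      unfolding drawn_insert
      by (subst interior_closed_Un_empty_interior)
         (auto simp: interior_arc_empty arc_edge arc_imp_path closed_path_image)
  qed simp
qed

lemma open_not_subset_drawn:
  assumes "open S" "S \<noteq> {}" "F \<subseteq> E"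
  obtains z where "z \<in> S" "z \<notin> drawn F"
  using interior_maximal[of S "drawn F"] interior_drawn[OF assms(3)] assms(1,2) by blast

text \<open>A forest does not separate the plane. Without the edge \<open>e = {u, v}\<close> it
  splits into the part \<open>A\<close> reachable from \<open>u\<close> and the rest
  \<open>B\<close>. \<open>A\<close> meets \<open>e\<close> at most in \<open>pos u\<close>, and
  their union meets \<open>B\<close> at most in \<open>pos v\<close>; so Janiszewski's theorem,
  which wants a connected intersection, glues the three pieces. For \<open>e\<close> itself, an arc
  does not separate the plane.\<close>

lemma connected_compl_drawn_acyclic:
  assumes "T \<subseteq> E" "edge_acyclic T"
  shows "topological_space_class.connected (- drawn T)"
  using assms
proof (induction "card T" arbitrary: T rule: less_induct)
  case less
  have finT: "finite T"
    using less.prems finite_edges finite_subset by blast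
  show ?case
  proof (cases "T = {}")
    case True
    then show ?thesis by (simp add: convex_connected)
  next
    case False
    then obtain e where e: "e \<in> T"
      by blast
    then obtain u v where uv: "e = {u, v}" "u \<noteq> v"
      using less.prems card_edge[of e] by (metis card_2_iff subsetD)
    have nc: "\<not> uconn (T - {e}) u v"
      using less.prems(2) e unfolding edge_acyclic_def uv(1) by blast
    define A where "A = {d \<in> T - {e}. \<exists>x\<in>d. uconn (T - {e}) u x}"
    define B where "B = T - {e} - A"
    have A_conn: "uconn (T - {e}) u x" if x: "x \<in> \<Union>A" for x
    proof -
      obtain d y where d: "d \<in> T - {e}" "y \<in> d" "uconn (T - {e}) u y" "x \<in> d"
        using x by (auto simp: A_def)
      have "card d = 2"
        using d(1) less.prems card_edge by auto
      then obtain p q where "d = {p, q}"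
        by (auto simp: card_2_iff)
      then have "x = y \<or> {y, x} \<in> T - {e}"
        using d by (auto simp: insert_commute)
      then show ?thesis
        using d(3) uconn_edge uconn_trans by metis
    qed
    have T_eq: "T = A \<union> {e} \<union> B"
      using e by (auto simp: A_def B_def)
    have "card A < card T" "card B < card T"
      using finT e by (auto simp: A_def B_def intro!: psubset_card_mono)
    then have con: "topological_space_class.connected (- drawn A)" "topological_space_class.connected (- drawn B)"
      using less by (auto intro!: less.hyps intro: edge_acyclic_subset simp: A_def B_def)
    have sub: "A \<subseteq> E" "B \<subseteq> E" "e \<in> E"
      using less.prems e by (auto simp: A_def B_def)
    have "v \<notin> \<Union>A"
      using A_conn[of v] nc by metis
    then have "\<Union>A \<inter> \<Union>{e} \<subseteq> {u}"
      by (auto simp: uv(1))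
    moreover have "drawn A \<inter> drawn {e} \<subseteq> pos ` (\<Union>A \<inter> \<Union>{e})"
      using sub by (intro drawn_Int) (auto simp: A_def)
    ultimately have "drawn A \<inter> drawn {e} \<subseteq> {pos u}"
      by (metis (no_types, lifting) image_empty image_insert image_mono order_trans)
    then have "topological_space_class.connected (drawn A \<inter> drawn {e})"
      by (auto simp: subset_singleton_iff)
    moreover have "topological_space_class.connected (- drawn {e})"
      using arc_edge[OF sub(3)] by (simp add: drawn_insert connected_arc_complement)
    ultimately have Ae: "topological_space_class.connected (- drawn (A \<union> {e}))"
      unfolding drawn_Un
      using sub con(1) by (intro Janiszewski_connected) (auto intro: compact_drawn closed_drawn)
    have "u \<notin> \<Union>B"
      unfolding B_def A_def by (auto intro: uconn_refl)
    moreover have "\<Union>A \<inter> \<Union>B = {}"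
      using A_conn unfolding B_def A_def by blast
    ultimately have "\<Union>(A \<union> {e}) \<inter> \<Union>B \<subseteq> {v}"
      using uv(1) by auto
    moreover have "drawn (A \<union> {e}) \<inter> drawn B \<subseteq> pos ` (\<Union>(A \<union> {e}) \<inter> \<Union>B)"
      using sub by (intro drawn_Int) (auto simp: B_def)
    ultimately have "drawn (A \<union> {e}) \<inter> drawn B \<subseteq> {pos v}"
      by (metis (no_types, lifting) image_empty image_insert image_mono order_trans)
    then have "topological_space_class.connected (drawn (A \<union> {e}) \<inter> drawn B)"
      by (auto simp: subset_singleton_iff)
    then show ?thesis
      unfolding T_eq drawn_Un[of "A \<union> {e}" B]
      using sub Ae con(2) by (intro Janiszewski_connected) (auto intro: compact_drawn closed_drawn)
  qed
qed

section \<open>Curves along paths and cycles\<close>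

lemma oriented_edge_arc:
  assumes "{u, v} \<in> E"
  obtains g where "arc g" "pathstart g = pos u" "pathfinish g = pos v"
    "path_image g = path_image (\<gamma> {u, v})"
proof -
  let ?g = "\<gamma> {u, v}"
  have "pathstart ?g = pos u \<and> pathfinish ?g = pos v \<or> pathstart ?g = pos v \<and> pathfinish ?g = pos u"
    using edge_ends[OF assms] by (auto simp: doubleton_eq_iff)
  then show ?thesis
    using that[of ?g] that[of "reversepath ?g"] arc_edge[OF assms] by (auto simp: arc_reversepath)
qed

lemma path_arc:
  assumes "distinct xs" "path_edges xs \<subseteq> E" "2 \<le> length xs"
  shows "\<exists>g. arc g \<and> pathstart g = pos (hd xs) \<and> pathfinish g = pos (last xs) \<and>
    path_image g = drawn (path_edges xs)"
  using assms
proof (induction xs rule: path_edges.induct)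
  case (1 x y zs)
  then have xyE: "{x, y} \<in> E"
    by simp
  obtain h where h: "arc h" "pathstart h = pos x" "pathfinish h = pos y"
    "path_image h = path_image (\<gamma> {x, y})"
    using oriented_edge_arc[OF xyE] .
  show ?case
  proof (cases zs)
    case Nil
    then show ?thesis
      using h by (auto simp: drawn_insert)
  next
    case (Cons z zs')
    then obtain g where g: "arc g" "pathstart g = pos y" "pathfinish g = pos (last (y # zs))"
      "path_image g = drawn (path_edges (y # zs))"
      using 1 by auto
    have x: "x \<notin> \<Union>(path_edges (y # zs))"
      using 1(2) Union_path_edges[of "y # zs"] by auto
    then have "drawn {{x, y}} \<inter> drawn (path_edges (y # zs)) \<subseteq> pos ` (\<Union>{{x, y}} \<inter> \<Union>(path_edges (y # zs)))"
      using 1(3) xyE by (intro drawn_Int) auto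
    then have "path_image h \<inter> path_image g \<subseteq> {pos y}"
      using x by (auto simp: h g drawn_insert)
    then have "arc (h +++ g)"
      using h g by (intro arc_join) auto
    moreover have "path_image (h +++ g) = drawn (path_edges (x # y # zs))"
      using h g by (simp add: path_image_join drawn_insert)
    ultimately show ?thesis
      using h g by (intro exI[of _ "h +++ g"]) auto
  qed
qed auto

text \<open>The curve follows a path in \<open>F\<close> from \<open>u\<close> to \<open>v\<close>
  and returns along the edge. That \<open>drawn Q\<close> is connected and contains both ends is
  recorded because it will be the intersection of the curve with the drawing without the
  edge.\<close>

lemma cycle_curve:
  assumes "{u, v} \<in> E" "F \<subseteq> E - {{u, v}}" "uconn F u v"
  obtains c Q where "Q \<subseteq> F" "simple_path c" "pathfinish c = pathstart c"
    "path_image c = path_image (\<gamma> {u, v}) \<union> drawn Q"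
    "topological_space_class.connected (drawn Q)" "pos ` {u, v} \<subseteq> drawn Q"
proof -
  obtain xs where xs: "xs \<noteq> []" "hd xs = u" "last xs = v" "distinct xs" "path_edges xs \<subseteq> F"
    using uconn_imp_distinct_path[OF assms(3)] .
  have "u \<noteq> v"
    using card_edge[OF assms(1)] by auto
  then have "2 \<le> length xs"
    using xs by (cases xs; cases "tl xs") auto
  then obtain g where g: "arc g" "pathstart g = pos u" "pathfinish g = pos v"
    "path_image g = drawn (path_edges xs)"
    using path_arc[of xs] xs assms(2) by auto
  have "{v, u} \<in> E"
    using assms(1) by (simp add: insert_commute)
  then obtain h where h: "arc h" "pathstart h = pos v" "pathfinish h = pos u"
    "path_image h = path_image (\<gamma> {u, v})"
    using oriented_edge_arc[of v u] by (metis insert_commute)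
  have "drawn {{u, v}} \<inter> drawn (path_edges xs) \<subseteq> pos ` (\<Union>{{u, v}} \<inter> \<Union>(path_edges xs))"
    using assms xs by (intro drawn_Int) auto
  then have "path_image g \<inter> path_image h \<subseteq> {pos u, pos v}"
    by (auto simp: g h drawn_insert)
  then have "simple_path (g +++ h)"
    using g h by (intro simple_path_join_loop) auto
  moreover have "path_image (g +++ h) = path_image (\<gamma> {u, v}) \<union> drawn (path_edges xs)"
    using g h by (auto simp: path_image_join)
  moreover have "topological_space_class.connected (drawn (path_edges xs))"
    using g by (metis connected_arc_image)
  moreover have "pos ` {u, v} \<subseteq> drawn (path_edges xs)"
    using g by (metis empty_subsetI image_empty image_insert insert_subset pathfinish_in_path_image pathstart_in_path_image)
  ultimately show ?thesis
    using that[of "path_edges xs" "g +++ h"] xs(5) g(2) h(3) by simp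
qed

text \<open>
  Faces are represented by points, one in each of finitely many components of the complement, so
  that the number of faces need not be known to be finite. Every edge that closes a cycle adds a
  face: by the Jordan curve theorem it has points of the inside and of the outside of the cycle
  arbitrarily near.
\<close>

lemma many_faces:
  assumes "A \<subseteq> E" "T \<subseteq> E" "A \<inter> T = {}" "\<And>u v. {u, v} \<in> A \<Longrightarrow> uconn T u v"
  shows "\<exists>P. finite P \<and> P \<subseteq> - drawn E \<and> card A < card P \<and>
    pairwise (\<lambda>p q. \<not> connected_component (- drawn (T \<union> A)) p q) P"
proof -
  have "finite A"
    using assms(1) finite_edges finite_subset by blast
  then show ?thesis
    using assms(1,3,4)
  proof (induction rule: finite_induct)
    case empty
    \<comment> \<open>The points avoid all of \<open>drawn E\<close>, not only the part drawn so
      far, so that edges added later do not hit them.\<close>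
    obtain p where "p \<notin> drawn E"
      using open_not_subset_drawn[of UNIV E] by auto
    then show ?case
      by (intro exI[of _ "{p}"]) auto
  next
    case (insert e A)
    then obtain P where P: "finite P" "P \<subseteq> - drawn E" "card A < card P"
      "pairwise (\<lambda>p q. \<not> connected_component (- drawn (T \<union> A)) p q) P"
      by auto
    let ?X = "drawn (T \<union> A)" and ?Y = "drawn (T \<union> insert e A)"
    have eE: "e \<in> E" and TAE: "T \<union> A \<subseteq> E" and eTA: "e \<notin> T \<union> A"
      using insert assms(2) by auto
    obtain u v where uv: "e = {u, v}"
      using card_edge[OF eE] by (auto simp: card_2_iff)
    have "uconn T u v"
      using insert.prems(3) uv by simp
    then obtain c Q where c: "Q \<subseteq> T" "simple_path c" "pathfinish c = pathstart c"
      "path_image c = path_image (\<gamma> e) \<union> drawn Q"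
      using cycle_curve[of u v T] eE eTA assms(2) unfolding uv by (metis UnCI subset_Diff_insert Diff_empty)
    have cY: "path_image c \<subseteq> ?Y"
      using c(1,4) by (auto simp: drawn_def)
    obtain q where q: "q \<in> open_edge e"
      using open_edge_nonempty[OF eE] by blast
    then have "q \<notin> ?X"
      using open_edge_notin_drawn[OF eE TAE eTA] by blast
    then obtain r where r: "r > 0" "ball q r \<subseteq> - ?X"
      using closed_drawn[OF TAE] open_contains_ball[of "- ?X"] by auto
    have qc: "q \<in> path_image c"
      using q c(4) by (auto simp: open_edge_def)
    \<comment> \<open>Since \<open>q\<close> lies on the frontier of \<open>S\<close>, the open set
      \<open>ball q r \<inter> S\<close> is nonempty; the drawing has empty interior, so this set
      has a point off all edges.\<close>
    have near: "\<exists>z \<in> ball q r \<inter> S. z \<notin> drawn E" if S: "open S" "frontier S = path_image c" for S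
    proof -
      have "q \<in> closure S"
        using qc S(2) by (auto simp: frontier_def)
      then have "ball q r \<inter> S \<noteq> {}"
        using r(1) by (metis IntI centre_in_ball closure_iff_nhds_not_empty emptyE inf_commute open_ball order_refl)
      moreover have "open (ball q r \<inter> S)"
        using S(1) by auto
      ultimately show ?thesis
        using open_not_subset_drawn[of "ball q r \<inter> S" E] by blast
    qed
    note J = Jordan_inside_outside[OF c(2,3)]
    obtain a where a: "a \<in> ball q r" "a \<in> inside (path_image c)" "a \<notin> drawn E"
      using near[of "inside (path_image c)"] J by auto
    obtain b where b: "b \<in> ball q r" "b \<in> outside (path_image c)" "b \<notin> drawn E"
      using near[of "outside (path_image c)"] J by auto
    have abX: "connected_component (- ?X) a b"
      using a(1) b(1) r(2) by (meson connected_ball connected_component_def)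
    have YX: "connected_component (- ?X) x y" if "connected_component (- ?Y) x y" for x y
      using that by (rule connected_component_of_subset) (auto simp: drawn_def)
    have abY: "\<not> connected_component (- ?Y) a b"
    proof
      assume "connected_component (- ?Y) a b"
      then have "connected_component (- path_image c) a b"
        by (rule connected_component_of_subset) (use cY in auto)
      then have "b \<in> inside (path_image c)"
        using a(2) inside_same_component by blast
      then show False
        using b(2) J by blast
    qed
    \<comment> \<open>\<open>a\<close> and \<open>b\<close> lie in one old component, which contains
      at most one point of \<open>P\<close>. Replacing that point by the two new ones raises the
      count by at least one.\<close>
    define R where "R = {p \<in> P. \<not> connected_component (- ?X) a p}"
    have "a \<noteq> b"
      using a(2) b(2) J by blast
    moreover have "connected_component (- ?X) a a"
      using abX by (meson connected_component_in connected_component_refl)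
    ultimately have ab_notin: "a \<notin> R" "b \<notin> R" "a \<noteq> b"
      using abX unfolding R_def by auto
    have "card (P - R) \<le> 1"
      unfolding One_nat_def
    proof (subst card_le_Suc0_iff_eq)
      show "\<forall>x\<in>P - R. \<forall>y\<in>P - R. x = y"
        using P(4) connected_component_sym connected_component_trans
        unfolding R_def pairwise_def by (smt (verit, best) DiffE mem_Collect_eq)
    qed (use P(1) in auto)
    moreover have "card P = card R + card (P - R)"
      using P(1) by (metis R_def card_Diff_subset card_mono finite_subset le_add_diff_inverse mem_Collect_eq subsetI)
    moreover have "finite R"
      using P(1) by (simp add: R_def)
    ultimately have "card (insert a (insert b R)) \<ge> card P + 1"
      using ab_notin by simp
    then have "card (insert e A) < card (insert a (insert b R))"
      using P(3) insert.hyps by simp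
    moreover have "pairwise (\<lambda>p q. \<not> connected_component (- ?Y) p q) (insert a (insert b R))"
    proof -
      have nYa: "\<not> connected_component (- ?Y) a p" "\<not> connected_component (- ?Y) p a" if "p \<in> R" for p
        using that YX connected_component_sym unfolding R_def by blast+
      have nYb: "\<not> connected_component (- ?Y) b p" "\<not> connected_component (- ?Y) p b" if "p \<in> R" for p
        using that YX connected_component_sym connected_component_trans[OF abX] unfolding R_def by blast+
      have "\<not> connected_component (- ?Y) p q" if "p \<in> R" "q \<in> R" "p \<noteq> q" for p q
        using P(4) that YX unfolding R_def pairwise_def by blast
      then show ?thesis
        using nYa nYb abY connected_component_sym unfolding pairwise_def
        by (smt (verit, best) insert_iff)
    qed
    moreover have "insert a (insert b R) \<subseteq> - drawn E"
      using a(3) b(3) P(2) by (auto simp: R_def)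
    ultimately show ?case
      using \<open>finite R\<close> by (intro exI[of _ "insert a (insert b R)"]) auto
  qed
qed

text \<open>
  The drawing without the edge and the curve of the cycle meet in an arc, so Janiszewski's theorem
  applies to them.
\<close>

lemma same_face_if_same_side:
  assumes e: "{u, v} \<in> E" and c: "simple_path c" "pathfinish c = pathstart c"
    "path_image c = path_image (\<gamma> {u, v}) \<union> drawn Q"
    "topological_space_class.connected (drawn Q)" "pos ` {u, v} \<subseteq> drawn Q" "Q \<subseteq> E - {{u, v}}"
    and pq: "connected_component (- drawn (E - {{u, v}})) p q"
    and side: "p \<in> S" "q \<in> S" "S \<in> {inside (path_image c), outside (path_image c)}"
  shows "connected_component (- drawn E) p q"
proof -
  let ?X = "drawn (E - {{u, v}})"
  note J = Jordan_inside_outside[OF c(1,2)]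
  have "topological_space_class.connected S" "S \<subseteq> - path_image c"
    using side(3) J by (metis insertE singletonD, metis Un_upper1 Un_upper2 insertE singletonD)
  then have "connected_component (- path_image c) p q"
    using side by (meson connected_component_def)
  moreover have "drawn {{u, v}} \<inter> ?X \<subseteq> pos ` {u, v}"
    using drawn_Int[of "{{u, v}}" "E - {{u, v}}"] e by auto
  then have "?X \<inter> path_image c = drawn Q"
    using c(3,5) drawn_mono[OF c(6)] by (auto simp: drawn_insert)
  ultimately have "connected_component (- (?X \<union> path_image c)) p q"
    using pq c(4) closed_path_image[OF simple_path_imp_path[OF c(1)]]
    by (intro Janiszewski compact_drawn) auto
  moreover have "?X \<union> path_image c = drawn E"
    using c(3,6) e by (auto simp: drawn_def)
  ultimately show ?thesis
    by simp
qed

section \<open>Faces and the edges on their frontiers\<close>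

definition face :: "complex \<Rightarrow> complex set" where
  "face p = connected_component_set (- drawn E) p"

text \<open>Open edges are used because an edge may touch the frontier of a face in one of its ends
  only.\<close>

definition face_edges :: "complex \<Rightarrow> 'a set set" where
  "face_edges p = {e \<in> E. open_edge e \<inter> frontier (face p) \<noteq> {}}"

text \<open>
  Otherwise the frontier of the face lies in a closed set with connected complement, so the face
  fills this complement and no further edge can be drawn.
\<close>

lemma face_edges_not_acyclic:
  assumes "p \<notin> drawn E" "\<not> edge_acyclic E"
  shows "\<not> edge_acyclic (face_edges p)"
proof
  assume ac: "edge_acyclic (face_edges p)"
  let ?F = "face_edges p"
  have FE: "?F \<subseteq> E"
    by (auto simp: face_edges_def)
  have face_sub: "face p \<subseteq> - drawn E"
    unfolding face_def by (rule connected_component_subset)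
  \<comment> \<open>All vertices are added, since a frontier point may be an end of edges whose
    interiors miss the frontier. Deleting finitely many points from a connected open set of the
    plane keeps it connected.\<close>
  define Y where "Y = drawn ?F \<union> pos ` \<Union>E"
  have "finite (\<Union>E)"
    using finite_edges card_edge by (metis card.infinite finite_Union zero_neq_numeral)
  then have "topological_space_class.connected (- drawn ?F - pos ` \<Union>E)"
    using connected_compl_drawn_acyclic[OF FE ac] closed_drawn[OF FE]
    by (intro connected_open_delete_finite) auto
  then have conY: "topological_space_class.connected (- Y)"
    by (simp add: Y_def Diff_eq Compl_Un)
  have YE: "Y \<subseteq> drawn E"
    using drawn_mono[OF FE] pos_in_edge unfolding Y_def drawn_def by blast
  have fr: "frontier (face p) \<subseteq> Y"
  proof
    fix z assume z: "z \<in> frontier (face p)"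
    have "frontier (face p) \<subseteq> drawn E"
      unfolding face_def using frontier_of_connected_component_subset[of "- drawn E" p]
        closed_drawn[of E] frontier_subset_closed[of "drawn E"] by (auto simp: frontier_complement)
    then obtain e where "e \<in> E" "z \<in> path_image (\<gamma> e)"
      using z by (auto simp: drawn_def)
    then show "z \<in> Y"
      using z unfolding Y_def drawn_def face_edges_def open_edge_def by blast
  qed
  have "p \<in> face p"
    using assms(1) by (simp add: face_def)
  then have "- Y \<inter> face p \<noteq> {}"
    using assms(1) YE by blast
  then have YF: "- Y \<subseteq> face p"
    using connected_Int_frontier[OF conY, of "face p"] fr by blast
  have "e \<in> ?F" if e: "e \<in> E" for e
  proof (rule ccontr)
    assume n: "e \<notin> ?F"
    obtain z where z: "z \<in> open_edge e"
      using open_edge_nonempty[OF e] by blast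
    have "z \<notin> pos ` \<Union>E"
    proof
      assume "z \<in> pos ` \<Union>E"
      then obtain d x where d: "d \<in> E" "x \<in> d" "z = pos x"
        by auto
      then have "d \<noteq> e"
        using z by (auto simp: open_edge_def)
      then have "open_edge e \<inter> drawn {d} = {}"
        using d e by (intro open_edge_notin_drawn) auto
      then show False
        using z d pos_in_edge[of d x] by (auto simp: drawn_insert)
    qed
    then have "z \<in> - Y"
      using open_edge_notin_drawn[OF e FE n] z by (auto simp: Y_def)
    then have "z \<notin> drawn E"
      using YF face_sub by blast
    then show False
      using z e by (auto simp: drawn_def open_edge_def)
  qed
  then have "?F = E"
    using FE by blast
  then show False
    using ac assms(2) by simp
qed

text \<open>All faces at \<open>e\<close> lie in one component of the complement of the other edges:
  each comes near some point of the open edge, which is connected and misses the other edges. As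
  \<open>e\<close> is not a bridge, a closed curve runs through it, and two such faces on the same
  side of the curve coincide. There are only two sides.\<close>

lemma card_faces_at_edge:
  assumes e: "e \<in> E" and br: "\<And>u v. {u, v} \<in> E \<Longrightarrow> uconn (E - {{u, v}}) u v"
    and P: "finite P" "P \<subseteq> - drawn E" "pairwise (\<lambda>p q. \<not> connected_component (- drawn E) p q) P"
  shows "card {p \<in> P. e \<in> face_edges p} \<le> 2"
proof -
  obtain u v where uv: "e = {u, v}"
    using card_edge[OF e] by (auto simp: card_2_iff)
  have "{u, v} \<in> E"
    using e uv by simp
  obtain c Q where c: "Q \<subseteq> E - {{u, v}}" "simple_path c" "pathfinish c = pathstart c"
    "path_image c = path_image (\<gamma> {u, v}) \<union> drawn Q"
    "topological_space_class.connected (drawn Q)" "pos ` {u, v} \<subseteq> drawn Q"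
    using cycle_curve[OF \<open>{u, v} \<in> E\<close> order_refl br[OF \<open>{u, v} \<in> E\<close>]] .
  let ?X = "drawn (E - {{u, v}})"
  let ?I = "inside (path_image c)" and ?O = "outside (path_image c)"
  let ?P = "{p \<in> P. e \<in> face_edges p}"
  have near: "\<exists>q\<in>open_edge e. connected_component (- ?X) q p" if p: "p \<in> ?P" for p
  proof -
    obtain q where q: "q \<in> open_edge e" "q \<in> frontier (face p)"
      using p by (auto simp: face_edges_def)
    have "q \<notin> ?X"
      using q(1) open_edge_notin_drawn[OF e, of "E - {{u, v}}"] uv by auto
    then obtain r where r: "r > 0" "ball q r \<subseteq> - ?X"
      using closed_drawn[of "E - {{u, v}}"] open_contains_ball[of "- ?X"] by auto
    have "q \<in> closure (face p)"
      using q(2) by (auto simp: frontier_def)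
    then obtain z where z: "z \<in> face p" "z \<in> ball q r"
      using r(1) by (metis closure_approachable dist_commute mem_ball)
    have "connected_component (- ?X) q z"
      using r z(2) by (meson centre_in_ball connected_ball connected_component_def)
    moreover have "connected_component (- ?X) z p"
    proof -
      have "connected_component (- drawn E) p z"
        using z(1) by (simp add: face_def)
      then have "connected_component (- ?X) p z"
        by (rule connected_component_of_subset) (auto simp: drawn_def)
      then show ?thesis
        by (rule connected_component_sym)
    qed
    ultimately show ?thesis
      using q(1) connected_component_trans by blast
  qed
  have same: "connected_component (- ?X) p p'" if pp: "p \<in> ?P" "p' \<in> ?P" for p p'
  proof -
    obtain q q' where q: "q \<in> open_edge e" "connected_component (- ?X) q p"
      "q' \<in> open_edge e" "connected_component (- ?X) q' p'"
      using near pp by blast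
    have "open_edge e \<subseteq> - ?X"
      using open_edge_notin_drawn[OF e, of "E - {{u, v}}"] uv by auto
    then have "connected_component (- ?X) q q'"
      using q connected_open_edge[OF e] by (meson connected_component_def)
    then show ?thesis
      using connected_component_trans[OF connected_component_sym[OF q(2)]] connected_component_trans[OF _ q(4)]
      by blast
  qed
  have "path_image c \<subseteq> drawn E"
    unfolding c(4) using c(1) \<open>{u, v} \<in> E\<close> by (auto simp: drawn_def)
  moreover have "?I \<union> ?O = - path_image c"
    using Jordan_inside_outside[OF c(2,3)] by metis
  ultimately have sides: "?P \<subseteq> ?I \<union> ?O"
    using P(2) by auto
  have "card (?P \<inter> S) \<le> 1" if S: "S \<in> {?I, ?O}" for S
    unfolding One_nat_def
  proof (subst card_le_Suc0_iff_eq)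
    show "\<forall>x\<in>?P \<inter> S. \<forall>y\<in>?P \<inter> S. x = y"
    proof (intro ballI, rule ccontr)
      fix x y assume xy: "x \<in> ?P \<inter> S" "y \<in> ?P \<inter> S" "x \<noteq> y"
      then have "connected_component (- drawn E) x y"
        using S by (intro same_face_if_same_side[OF \<open>{u, v} \<in> E\<close> c(2-6) c(1) same, of x y S]) auto
      then show False
        using P(3) xy unfolding pairwise_def by blast
    qed
  qed (use P(1) in auto)
  then have "card (?P \<inter> ?I) \<le> 1" "card (?P \<inter> ?O) \<le> 1"
    by auto
  moreover have "?P = (?P \<inter> ?I) \<union> (?P \<inter> ?O)"
    using sides by blast
  ultimately show ?thesis
    using arg_cong[of _ _ card] card_Un_le[of "?P \<inter> ?I" "?P \<inter> ?O"] by fastforce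
qed

lemma few_faces:
  assumes ne: "E \<noteq> {}" and br: "\<And>u v. {u, v} \<in> E \<Longrightarrow> uconn (E - {{u, v}}) u v"
    and girth: "\<And>F. F \<subseteq> E \<Longrightarrow> \<not> edge_acyclic F \<Longrightarrow> 6 \<le> card F"
    and P: "finite P" "P \<subseteq> - drawn E" "pairwise (\<lambda>p q. \<not> connected_component (- drawn E) p q) P"
  shows "3 * card P \<le> card E"
proof -
  obtain u v where "{u, v} \<in> E"
    using ne card_edge by (metis card_2_iff ex_in_conv)
  then have nac: "\<not> edge_acyclic E"
    using br unfolding edge_acyclic_def by blast
  \<comment> \<open>Double counting of pairs of a chosen point and an edge in its
    \<open>face_edges\<close>.\<close>
  have "6 * card P = (\<Sum>p\<in>P. 6)"
    by simp
  also have "\<dots> \<le> (\<Sum>p\<in>P. card (face_edges p))"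
    using P(2) face_edges_not_acyclic nac by (intro sum_mono girth) (auto simp: face_edges_def)
  also have "\<dots> = (\<Sum>p\<in>P. \<Sum>e\<in>E. if e \<in> face_edges p then 1 else 0)"
    using finite_edges by (intro sum.cong) (auto simp: face_edges_def sum.If_cases intro!: arg_cong[of _ _ card])
  also have "\<dots> = (\<Sum>e\<in>E. \<Sum>p\<in>P. if e \<in> face_edges p then 1 else 0)"
    by (rule sum.swap)
  also have "\<dots> = (\<Sum>e\<in>E. card {p \<in> P. e \<in> face_edges p})"
    using P(1) by (intro sum.cong) (auto simp: sum.If_cases Int_def)
  also have "\<dots> \<le> (\<Sum>e\<in>E. 2)"
    using card_faces_at_edge br P by (intro sum_mono) auto
  finally show ?thesis
    by simp
qed

end

text \<open>The bound is stated against a forest rather than the vertices so that the induction can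
  remove bridges: each adds 2 on the left and 3 on the right. A nonempty bridgeless set has
  \<open>card E - card T < card P\<close> and \<open>3 * card P \<le> card E\<close>.\<close>

lemma plane_edges_sparse_forest:
  assumes "plane_edges E pos \<gamma>" "\<And>F. F \<subseteq> E \<Longrightarrow> \<not> edge_acyclic F \<Longrightarrow> 6 \<le> card F"
  shows "\<exists>T\<subseteq>E. edge_acyclic T \<and> 2 * card E \<le> 3 * card T"
  using assms
proof (induction "card E" arbitrary: E rule: less_induct)
  case less
  interpret plane_edges E pos \<gamma> by fact
  show ?case
  proof (cases "\<exists>u v. {u, v} \<in> E \<and> \<not> uconn (E - {{u, v}}) u v")
    case True
    then obtain u v where uv: "{u, v} \<in> E" "\<not> uconn (E - {{u, v}}) u v"
      by blast
    let ?E = "E - {{u, v}}"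
    have "card ?E < card E"
      using uv finite_edges by (intro psubset_card_mono) auto
    moreover have "plane_edges ?E pos \<gamma>"
      by (rule plane_edges_subset) auto
    ultimately obtain T where T: "T \<subseteq> ?E" "edge_acyclic T" "2 * card ?E \<le> 3 * card T"
      using less.hyps[of ?E] less.prems(2) by auto
    have "\<not> uconn T u v"
      using uv(2) T(1) uconn_mono by metis
    then have "edge_acyclic (insert {u, v} T)"
      by (rule edge_acyclic_insert[OF T(2)])
    moreover have "card (insert {u, v} T) = card T + 1"
      using T(1) finite_edges by (subst card_insert_disjoint) (auto intro: finite_subset)
    moreover have "card E = card ?E + 1"
      using card.remove[OF finite_edges uv(1)] by simp
    ultimately show ?thesis
      using T uv(1) by (intro exI[of _ "insert {u, v} T"] conjI) (metis Diff_subset insert_subset order_trans, assumption, linarith)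
  next
    case False
    then have br: "\<And>u v. {u, v} \<in> E \<Longrightarrow> uconn (E - {{u, v}}) u v"
      by blast
    show ?thesis
    proof (cases "E = {}")
      case True
      then show ?thesis by auto
    next
      case ne: False
      obtain T where T: "T \<subseteq> E" "edge_acyclic T" "\<And>u v. {u, v} \<in> E \<Longrightarrow> uconn T u v"
        using edge_acyclic_spanning[OF finite_edges card_edge] by metis
      obtain P where P: "finite P" "P \<subseteq> - drawn E" "card (E - T) < card P"
        "pairwise (\<lambda>p q. \<not> connected_component (- drawn (T \<union> (E - T))) p q) P"
        using many_faces[of "E - T" T] T by blast
      have "T \<union> (E - T) = E"
        using T(1) by blast
      then have "3 * card P \<le> card E"
        using few_faces[OF ne br less.prems(2) P(1,2)] P(4) by simp
      moreover have "card (E - T) = card E - card T" "card T \<le> card E"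
        using T(1) finite_edges by (auto simp: card_Diff_subset finite_subset card_mono)
      ultimately have "2 * card E \<le> 3 * card T"
        using P(3) by linarith
      then show ?thesis
        using T by blast
    qed
  qed
qed

corollary plane_edges_sparse:
  assumes "plane_edges E pos \<gamma>" "\<And>F. F \<subseteq> E \<Longrightarrow> \<not> edge_acyclic F \<Longrightarrow> 6 \<le> card F"
    "finite V" "V \<noteq> {}" "\<Union>E \<subseteq> V"
  shows "2 * card E < 3 * card V"
proof -
  interpret plane_edges E pos \<gamma> by fact
  obtain T where T: "T \<subseteq> E" "edge_acyclic T" "2 * card E \<le> 3 * card T"
    using plane_edges_sparse_forest[OF assms(1,2)] by blast
  have "card T < card V"
    using T assms(3-5) finite_edges by (intro edge_acyclic_card_less) (auto simp: finite_subset card_edge)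
  then show ?thesis
    using T(3) by linarith
qed

subsection \<open>Equitable forest partitions of sparse graphs\<close>

text \<open>Every induced subgraph has average degree below 3. The condition ranges over all
  nonempty \<open>W\<close> because the colouring is built by induction on induced
  subgraphs.\<close>

locale sparse_edges =
  fixes V :: "'a set" and E :: "'a set set"
  assumes finite_V: "finite V"
    and card_edge: "e \<in> E \<Longrightarrow> card e = 2"
    and sparse: "W \<subseteq> V \<Longrightarrow> W \<noteq> {} \<Longrightarrow> 2 * card {e \<in> E. e \<subseteq> W} < 3 * card W"
begin

definition nbrs :: "'a \<Rightarrow> 'a set \<Rightarrow> 'a set" where
  "nbrs x W = {y \<in> W. {x, y} \<in> E}"

lemma edge_sym: "{x, y} \<in> E \<longleftrightarrow> {y, x} \<in> E"
  by (simp add: insert_commute)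

lemma no_loop: "{x, x} \<notin> E"
  using card_edge[of "{x, x}"] by auto

lemma nbrs_mono: "U \<subseteq> W \<Longrightarrow> nbrs x U \<subseteq> nbrs x W"
  by (auto simp: nbrs_def)

lemma finite_nbrs: "finite W \<Longrightarrow> finite (nbrs x W)"
  by (simp add: nbrs_def)

lemma card_nbrs_mono: "finite W \<Longrightarrow> U \<subseteq> W \<Longrightarrow> card (nbrs x U) \<le> card (nbrs x W)"
  by (simp add: card_mono finite_nbrs nbrs_mono)

lemma handshake:
  assumes "finite W"
  shows "(\<Sum>x\<in>W. card (nbrs x W)) = 2 * card {e \<in> E. e \<subseteq> W}"
proof -
  let ?F = "{e \<in> E. e \<subseteq> W}"
  have finF: "finite ?F"
    by (rule finite_subset[of _ "Pow W"]) (use assms in auto)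
  have "card (nbrs x W) = card {e \<in> ?F. x \<in> e}" if x: "x \<in> W" for x
  proof -
    have "bij_betw (\<lambda>y. {x, y}) (nbrs x W) {e \<in> ?F. x \<in> e}"
    proof (rule bij_betw_imageI)
      show "inj_on (\<lambda>y. {x, y}) (nbrs x W)"
        by (rule inj_onI) (metis doubleton_eq_iff)
      show "(\<lambda>y. {x, y}) ` nbrs x W = {e \<in> ?F. x \<in> e}"
      proof (intro set_eqI iffI)
        fix e assume e: "e \<in> {e \<in> ?F. x \<in> e}"
        then have "card e = 2"
          using card_edge by simp
        then obtain a b where "e = {a, b}"
          by (auto simp: card_2_iff)
        then obtain y where "e = {x, y}"
          using e by (auto simp: insert_commute)
        then show "e \<in> (\<lambda>y. {x, y}) ` nbrs x W"
          using e by (simp add: nbrs_def)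
      qed (use x in \<open>auto simp: nbrs_def\<close>)
    qed
    then show ?thesis
      by (rule bij_betw_same_card)
  qed
  then have "(\<Sum>x\<in>W. card (nbrs x W)) = (\<Sum>x\<in>W. \<Sum>e\<in>?F. if x \<in> e then 1 else 0)"
    using finF by (intro sum.cong refl) (simp add: sum.If_cases Int_def)
  also have "\<dots> = (\<Sum>e\<in>?F. \<Sum>x\<in>W. if x \<in> e then 1 else 0)"
    by (rule sum.swap)
  also have "\<dots> = (\<Sum>e\<in>?F. 2)"
  proof (intro sum.cong refl)
    fix e assume e: "e \<in> ?F"
    then have "W \<inter> {x. x \<in> e} = e"
      by auto
    then show "(\<Sum>x\<in>W. if x \<in> e then 1 else 0) = (2::nat)"
      using e assms card_edge by (simp add: sum.If_cases)
  qed
  finally show ?thesis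
    by simp
qed

lemma sum_nbrs_less:
  assumes "W \<subseteq> V" "W \<noteq> {}"
  shows "(\<Sum>x\<in>W. card (nbrs x W)) < 3 * card W"
  using handshake[of W] sparse[OF assms] assms(1) finite_V finite_subset by metis

lemma exists_card_nbrs_le_2:
  assumes "W \<subseteq> V" "W \<noteq> {}"
  obtains x where "x \<in> W" "card (nbrs x W) \<le> 2"
proof -
  have "\<exists>x\<in>W. card (nbrs x W) \<le> 2"
  proof (rule ccontr)
    assume "\<not> ?thesis"
    then have "(\<Sum>x\<in>W. 3) \<le> (\<Sum>x\<in>W. card (nbrs x W))"
      by (intro sum_mono) force
    then show False
      using sum_nbrs_less[OF assms] by simp
  qed
  then show ?thesis
    using that by blast
qed

text \<open>
  Discharging: every vertex gives 1/2 to each neighbour of degree 2. If no configuration occurs,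
  every vertex ends up with at least 3. All charges are doubled below.
\<close>

lemma reducible_configuration:
  assumes W: "W \<subseteq> V" "W \<noteq> {}"
  obtains
    (leaf) x where "x \<in> W" "card (nbrs x W) \<le> 1"
  | (light) x y where "x \<in> W" "y \<in> W" "{x, y} \<in> E" "card (nbrs x W) = 2" "card (nbrs y W) \<le> 4"
  | (star) v where "v \<in> W" "card (nbrs v W) = 5" "\<And>w. w \<in> nbrs v W \<Longrightarrow> card (nbrs w W) = 2"
proof (rule ccontr)
  let ?d = "\<lambda>x. card (nbrs x W)"
  let ?k = "\<lambda>x. card {y \<in> nbrs x W. ?d y = 2}"
  assume "\<not> thesis"
  then have leaf: "\<And>x. x \<in> W \<Longrightarrow> 2 \<le> ?d x"
    and light: "\<And>x y. x \<in> W \<Longrightarrow> y \<in> W \<Longrightarrow> {x, y} \<in> E \<Longrightarrow> ?d x = 2 \<Longrightarrow> 5 \<le> ?d y"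
    and star: "\<And>v. v \<in> W \<Longrightarrow> ?d v = 5 \<Longrightarrow> \<exists>w\<in>nbrs v W. ?d w \<noteq> 2"
    using that by (metis One_nat_def Suc_1 not_less_eq_eq,
      metis One_nat_def Suc_1 not_less_eq_eq numeral_eq_Suc pred_numeral_simps(3) eval_nat_numeral(3),
      metis)
  have finW: "finite W"
    using W finite_V finite_subset by blast
  \<comment> \<open>This says that the final charge is at least 3, doubled. By \<open>light\<close>,
    vertices of degree at most 4 have no neighbour of degree 2 and give nothing; those of degree 2
    receive 1 in all. By \<open>star\<close>, degree 5 gives to at most four neighbours and keeps 5
    - 2. Degree d \<ge> 6 keeps at least d/2.\<close>
  have pt: "6 + ?k x \<le> 2 * ?d x + (if ?d x = 2 then 2 else 0)" if x: "x \<in> W" for x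
  proof -
    have k_le: "?k x \<le> ?d x"
      using finW by (intro card_mono finite_nbrs) auto
    have k0: "?k x = 0" if "?d x \<le> 4"
    proof -
      have "{y \<in> nbrs x W. ?d y = 2} = {}"
      proof (rule ccontr)
        assume "{y \<in> nbrs x W. ?d y = 2} \<noteq> {}"
        then obtain y where "y \<in> W" "{x, y} \<in> E" "?d y = 2"
          by (auto simp: nbrs_def)
        then show False
          using light[of y x] x that edge_sym[of x y] by simp
      qed
      then show ?thesis
        by (metis card.empty)
    qed
    have k4: "?k x \<le> 4" if d5: "?d x = 5"
    proof -
      have "{y \<in> nbrs x W. ?d y = 2} \<subset> nbrs x W"
        using star[OF x d5] by auto
      then have "?k x < ?d x"
        using finW by (intro psubset_card_mono finite_nbrs)
      then show ?thesis
        using d5 by simp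
    qed
    consider "?d x = 2" | "?d x = 3" | "?d x = 4" | "?d x = 5" | "6 \<le> ?d x"
      using leaf[OF x] by linarith
    then show ?thesis
      using k_le k0 k4 by cases auto
  qed
  have "(\<Sum>x\<in>W. ?k x) = (\<Sum>x\<in>W. \<Sum>y\<in>W. if {x, y} \<in> E \<and> ?d y = 2 then 1 else 0)"
    using finW by (intro sum.cong refl) (simp add: sum.If_cases nbrs_def Int_def conj_assoc)
  also have "\<dots> = (\<Sum>y\<in>W. \<Sum>x\<in>W. if {x, y} \<in> E \<and> ?d y = 2 then 1 else 0)"
    by (rule sum.swap)
  also have "\<dots> = (\<Sum>y\<in>W. if ?d y = 2 then 2 else 0)"
  proof (intro sum.cong refl)
    fix y assume "y \<in> W"
    have "W \<inter> {x. {x, y} \<in> E} = nbrs y W"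
      by (auto simp: nbrs_def insert_commute)
    then show "(\<Sum>x\<in>W. if {x, y} \<in> E \<and> ?d y = 2 then 1 else 0) = (if ?d y = 2 then 2 else 0::nat)"
      using finW by (simp add: sum.If_cases)
  qed
  finally have k_sum: "(\<Sum>x\<in>W. ?k x) = (\<Sum>y\<in>W. if ?d y = 2 then 2 else 0)" .
  have "(\<Sum>x\<in>W. 6 + ?k x) \<le> (\<Sum>x\<in>W. 2 * ?d x + (if ?d x = 2 then 2 else 0))"
    using pt by (rule sum_mono)
  then have "6 * card W \<le> 2 * (\<Sum>x\<in>W. ?d x)"
    using k_sum by (simp add: sum.distrib sum_distrib_left)
  then show False
    using sum_nbrs_less[OF W] by simp
qed

section \<open>Vertex sets that induce forests\<close>

definition induces_forest :: "'a set \<Rightarrow> bool" where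
  "induces_forest A \<longleftrightarrow> edge_acyclic {e \<in> E. e \<subseteq> A}"

lemma induces_forest_empty: "induces_forest {}"
  using card_edge unfolding induces_forest_def edge_acyclic_def by force

text \<open>A vertex outside \<open>A\<close> is isolated in the graph of edges inside
  \<open>A\<close>, so the at most one edge that it brings closes no cycle.\<close>

lemma induces_forest_insert:
  assumes "induces_forest A" "finite A" "card (nbrs x A) \<le> 1"
  shows "induces_forest (insert x A)"
proof (cases "x \<in> A")
  case True
  then show ?thesis
    using assms(1) by (simp add: insert_absorb)
next
  case False
  let ?F = "{e \<in> E. e \<subseteq> A}"
  have new: "e \<in> ?F \<or> (\<exists>z\<in>nbrs x A. e = {x, z})" if e: "e \<in> E" "e \<subseteq> insert x A" for e
  proof (cases "x \<in> e")
    case True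
    obtain a b where "e = {a, b}" "a \<noteq> b"
      using card_edge[OF e(1)] by (auto simp: card_2_iff)
    then obtain z where "e = {x, z}" "z \<noteq> x"
      using True by (auto simp: insert_commute)
    then show ?thesis
      using e by (auto simp: nbrs_def)
  next
    case False
    then show ?thesis
      using e by auto
  qed
  have "nbrs x A = {} \<or> (\<exists>y. nbrs x A = {y})"
    using assms(2,3) finite_nbrs[of A x] by (metis One_nat_def card_0_eq card_1_singletonE le_Suc_eq le_zero_eq)
  then show ?thesis
  proof
    assume "nbrs x A = {}"
    then have "{e \<in> E. e \<subseteq> insert x A} \<subseteq> ?F"
      using new by blast
    then show ?thesis
      using assms(1) edge_acyclic_subset unfolding induces_forest_def by metis
  next
    assume "\<exists>y. nbrs x A = {y}"
    then obtain y where y: "nbrs x A = {y}"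
      by blast
    have "y \<noteq> x"
      using y False by (auto simp: nbrs_def)
    have "\<not> uconn ?F x y"
    proof
      assume "uconn ?F x y"
      then show False
        unfolding uconn_def by (cases rule: converse_rtranclpE) (use False \<open>y \<noteq> x\<close> in simp_all)
    qed
    then have "edge_acyclic (insert {x, y} ?F)"
      using assms(1) edge_acyclic_insert[of ?F x y] unfolding induces_forest_def by simp
    moreover have "{e \<in> E. e \<subseteq> insert x A} \<subseteq> insert {x, y} ?F"
      using new y by auto
    ultimately show ?thesis
      using edge_acyclic_subset unfolding induces_forest_def by metis
  qed
qed

text \<open>The vertices of \<open>S\<close> are added one by one; the degree bound in the larger
  set \<open>Z\<close> covers every stage, in whatever order they come.\<close>

lemma induces_forest_Un:
  assumes "finite S" "induces_forest A" "finite Z" "A \<union> S \<subseteq> Z" "\<And>w. w \<in> S \<Longrightarrow> card (nbrs w Z) \<le> 1"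
  shows "induces_forest (A \<union> S)"
  using assms(1,4,5)
proof (induction rule: finite_induct)
  case empty
  then show ?case using assms(2) by simp
next
  case (insert w S)
  have "card (nbrs w (A \<union> S)) \<le> card (nbrs w Z)"
    using insert.prems assms(3) by (intro card_nbrs_mono) auto
  then have "card (nbrs w (A \<union> S)) \<le> 1"
    using insert.prems(2)[of w] by simp
  moreover have "finite (A \<union> S)"
    using insert.prems(1) assms(3) by (auto intro: finite_subset)
  ultimately show ?case
    using induces_forest_insert[of "A \<union> S" w] insert by auto
qed

text \<open>
  The \<open>i\<close>-th vertex counted from the end of the list has at most \<open>2 * i - 1\<close> neighbours in \<open>U\<close>.
  Hence at most \<open>i - 1\<close> colours occur twice among them, and colours can be handed out greedily
  from the head of the list.
\<close>

fun ordered_for :: "'a set \<Rightarrow> 'a list \<Rightarrow> bool" where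
  "ordered_for U [] = True"
| "ordered_for U (x # xs) = (card (nbrs x U) \<le> 2 * length xs + 1 \<and> ordered_for U xs)"

lemma ordered_for_antimono: "ordered_for W xs \<Longrightarrow> finite W \<Longrightarrow> U \<subseteq> W \<Longrightarrow> ordered_for U xs"
  by (induction xs) (auto dest: card_nbrs_mono intro: order_trans)

text \<open>Average degree below 3 always leaves a vertex with at most 2 neighbours among the
  remaining ones. It may be put in front of a nonempty list, where the bound is at least 3. The
  older bounds persist, as the set outside the list only shrinks. The last position, with its bound
  1, is what \<open>ys\<close> has to provide.\<close>

lemma ordered_for_extend:
  assumes "W \<subseteq> V" "t \<le> card W" "set ys \<subseteq> W" "distinct ys" "ys \<noteq> []" "length ys \<le> t"
    "ordered_for (W - set ys) ys"
  obtains xs where "set xs \<subseteq> W" "distinct xs" "length xs = t" "ordered_for (W - set xs) xs"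
proof -
  have finW: "finite W"
    using assms(1) finite_V finite_subset by blast
  have "\<exists>xs. set xs \<subseteq> W \<and> distinct xs \<and> length xs = t \<and> ordered_for (W - set xs) xs"
    using assms(3-7)
  proof (induction "t - length ys" arbitrary: ys)
    case 0
    then show ?case by (intro exI[of _ ys]) auto
  next
    case (Suc n)
    let ?U = "W - set ys"
    have "card (set ys) < card W"
      using Suc.hyps(2) Suc.prems(2) assms(2) by (simp add: distinct_card)
    then have "?U \<noteq> {}"
      by (metis Diff_eq_empty_iff List.finite_set card_mono not_le)
    then obtain x where x: "x \<in> ?U" "card (nbrs x ?U) \<le> 2"
      using exists_card_nbrs_le_2[of ?U] assms(1) by blast
    have sub: "W - set (x # ys) \<subseteq> ?U"
      by auto
    then have "card (nbrs x (W - set (x # ys))) \<le> card (nbrs x ?U)"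
      using finW by (intro card_nbrs_mono) auto
    moreover have "1 \<le> length ys"
      using Suc.prems(3) by (cases ys) auto
    moreover have "ordered_for (W - set (x # ys)) ys"
      using Suc.prems(5) finW sub by (meson finite_Diff ordered_for_antimono)
    ultimately have "ordered_for (W - set (x # ys)) (x # ys)"
      using x(2) by simp
    then show ?case
      using Suc x by (intro Suc.hyps(1)[of "x # ys"]) auto
  qed
  then show ?thesis
    using that by blast
qed

lemma ordered_for_assignment:
  assumes "finite U" "distinct xs" "ordered_for U xs" "finite C" "card C = length xs"
  shows "\<exists>g. bij_betw g (set xs) C \<and> (\<forall>x\<in>set xs. card {y \<in> nbrs x U. f y = g x} \<le> 1)"
  using assms(2-5)
proof (induction xs arbitrary: C)
  case Nil
  then show ?case by (auto simp: bij_betw_def)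
next
  case (Cons x xs)
  have "\<exists>c\<in>C. card {y \<in> nbrs x U. f y = c} \<le> 1"
  proof (rule ccontr)
    assume "\<not> ?thesis"
    then have "(\<Sum>c\<in>C. 2) \<le> (\<Sum>c\<in>C. card {y \<in> nbrs x U. f y = c})"
      by (intro sum_mono) force
    also have "\<dots> = card (\<Union>c\<in>C. {y \<in> nbrs x U. f y = c})"
      using assms(1) Cons.prems(3) finite_nbrs by (intro card_UN_disjoint[symmetric]) auto
    also have "\<dots> \<le> card (nbrs x U)"
      using assms(1) finite_nbrs by (intro card_mono) auto
    finally show False
      using Cons.prems by simp
  qed
  then obtain c where c: "c \<in> C" "card {y \<in> nbrs x U. f y = c} \<le> 1"
    by blast
  have "finite (C - {c})" "card (C - {c}) = length xs"
    using Cons.prems(3,4) c(1) by auto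
  then obtain g where g: "bij_betw g (set xs) (C - {c})"
      "\<forall>x\<in>set xs. card {y \<in> nbrs x U. f y = g x} \<le> 1"
    using Cons.IH[of "C - {c}"] Cons.prems(1,2) by (metis distinct.simps(2) ordered_for.simps(2))
  let ?g = "g(x := c)"
  have "bij_betw ?g (set xs) (C - {c})"
    using g(1) Cons.prems(1) by (subst bij_betw_cong[of _ _ g]) auto
  then have "bij_betw ?g (insert x (set xs)) (insert c (C - {c}))"
    using Cons.prems(1) by (subst insert_is_Un[of x], subst insert_is_Un[of c], intro bij_betw_combine)
      (auto simp: bij_betw_def)
  then have "bij_betw ?g (set (x # xs)) C"
    using c(1) by (simp add: insert_absorb)
  moreover have "\<forall>z\<in>set (x # xs). card {y \<in> nbrs z U. f y = ?g z} \<le> 1"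
    using g(2) c(2) Cons.prems(1) by auto
  ultimately show ?case
    by blast
qed

section \<open>Equitable partitions and their extension\<close>

definition equitable_forests :: "'a set \<Rightarrow> nat \<Rightarrow> ('a \<Rightarrow> nat) \<Rightarrow> bool" where
  "equitable_forests W t f \<longleftrightarrow> f ` W \<subseteq> {1..t} \<and>
     (\<forall>i\<in>{1..t}. \<forall>j\<in>{1..t}. card {v \<in> W. f v = i} \<le> card {v \<in> W. f v = j} + 1) \<and>
     (\<forall>i\<in>{1..t}. induces_forest {v \<in> W. f v = i})"

lemma equitable_forests_small:
  assumes "finite W" "card W \<le> t"
  shows "\<exists>f. equitable_forests W t f"
proof -
  obtain f where f: "inj_on f W" "f ` W \<subseteq> {1..t}"
    using inj_on_iff_card_le[of W "{1..t}"] assms by auto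
  have cls: "{v \<in> W. f v = i} = {} \<or> (\<exists>x. {v \<in> W. f v = i} = {x})" for i
  proof (cases "\<exists>x\<in>W. f x = i")
    case True
    then obtain x where x: "x \<in> W" "f x = i"
      by blast
    then have "{v \<in> W. f v = i} = {x}"
      using x f(1) by (auto dest: inj_onD)
    then show ?thesis
      by blast
  qed auto
  have "induces_forest {x}" for x
    using induces_forest_insert[OF induces_forest_empty, of x] by (simp add: nbrs_def)
  then have "induces_forest {v \<in> W. f v = i}" for i
    using cls[of i] induces_forest_empty by metis
  moreover have "card {v \<in> W. f v = i} \<le> 1" for i
    using cls[of i] by (metis One_nat_def card.empty is_singletonI is_singleton_altdef le_0_eq le_refl nat_le_linear)
  ultimately show ?thesis
    using f(2) unfolding equitable_forests_def by (meson le_add2 order_trans)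
qed

text \<open>Each class gains exactly one vertex of the list, so the differences in size do not
  change, and edges between list vertices lie in no class. The new vertex has at most one neighbour
  in its class.\<close>

lemma equitable_forests_extend:
  assumes W: "W \<subseteq> V" and xs: "set xs \<subseteq> W" "distinct xs" "length xs = t" "ordered_for (W - set xs) xs"
    and f: "equitable_forests (W - set xs) t f"
  shows "\<exists>h. equitable_forests W t h"
proof -
  let ?U = "W - set xs"
  have finU: "finite ?U"
    using W finite_V finite_subset by blast
  obtain g where g: "bij_betw g (set xs) {1..t}" "\<And>x. x \<in> set xs \<Longrightarrow> card {y \<in> nbrs x ?U. f y = g x} \<le> 1"
    using ordered_for_assignment[OF finU xs(2,4), of "{1..t}" f] xs(3) by auto
  define h where "h v = (if v \<in> set xs then g v else f v)" for v
  have cls: "card {v \<in> W. h v = i} = card {v \<in> ?U. f v = i} + 1 \<and> induces_forest {v \<in> W. h v = i}"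
    if i: "i \<in> {1..t}" for i
  proof -
    obtain x where x: "x \<in> set xs" "g x = i"
      using g(1) i by (metis bij_betw_imp_surj_on imageE)
    have uniq: "y = x" if "y \<in> set xs" "g y = i" for y
      using g(1) x that by (metis bij_betw_imp_inj_on inj_onD)
    have eq: "{v \<in> W. h v = i} = insert x {v \<in> ?U. f v = i}"
      using x xs(1) by (auto simp: h_def dest: uniq split: if_splits)
    have "nbrs x {v \<in> ?U. f v = i} = {y \<in> nbrs x ?U. f y = g x}"
      using x(2) by (auto simp: nbrs_def)
    then have "induces_forest (insert x {v \<in> ?U. f v = i})"
      using f i g(2)[OF x(1)] finU by (intro induces_forest_insert) (auto simp: equitable_forests_def)
    then show ?thesis
      using eq x(1) finU by simp
  qed
  moreover have "h ` W \<subseteq> {1..t}"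
  proof
    fix i assume "i \<in> h ` W"
    then obtain v where v: "v \<in> W" "i = h v"
      by blast
    then show "i \<in> {1..t}"
      using f bij_betwE[OF g(1)] by (cases "v \<in> set xs") (auto simp: h_def equitable_forests_def image_subset_iff)
  qed
  ultimately have "equitable_forests W t h"
    using f unfolding equitable_forests_def by simp
  then show ?thesis
    by blast
qed

text \<open>
  The centre and two of its neighbours \<open>a\<close>, \<open>b\<close> get a colour \<open>c\<close> that does not occur on
  the outer neighbour of \<open>a\<close>; the other three neighbours get the colour \<open>3 - c\<close>.
\<close>

lemma equitable_forests_extend_star:
  assumes W: "W \<subseteq> V" and v: "v \<in> W" "card (nbrs v W) = 5"
    and w2: "\<And>w. w \<in> nbrs v W \<Longrightarrow> card (nbrs w W) = 2"
    and f: "equitable_forests (W - insert v (nbrs v W)) 2 f"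
  shows "\<exists>h. equitable_forests W 2 h"
proof -
  let ?N = "nbrs v W" and ?Z = "W - {v}"
  let ?U = "W - insert v ?N"
  have fin: "finite W" "finite ?N" "finite ?U"
    using W finite_V finite_subset finite_nbrs by blast+
  have vN: "v \<notin> ?N"
    using no_loop[of v] by (simp add: nbrs_def)
  have N1: "card (nbrs w ?Z) \<le> 1" if w: "w \<in> ?N" for w
  proof -
    have "v \<in> nbrs w W"
      using w v(1) edge_sym[of v w] by (simp add: nbrs_def)
    moreover have "nbrs w ?Z = nbrs w W - {v}"
      by (auto simp: nbrs_def)
    ultimately show ?thesis
      using w2[OF w] by (simp add: card_Diff_singleton)
  qed
  obtain a where a: "a \<in> ?N"
    using v(2) by (metis card.empty ex_in_conv zero_neq_numeral)
  have "?U \<subseteq> ?Z"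
    by auto
  then have aU: "finite (nbrs a ?Z)" "nbrs a ?U \<subseteq> nbrs a ?Z"
    using fin by (simp_all add: finite_nbrs nbrs_mono)
  obtain c where c: "c \<in> {1, 2::nat}" "\<And>y. y \<in> nbrs a ?U \<Longrightarrow> f y \<noteq> c"
  proof (cases "\<exists>y\<in>nbrs a ?U. f y = 1")
    case True
    then obtain y where y: "y \<in> nbrs a ?U" "f y = 1"
      by blast
    have "z = y" if "z \<in> nbrs a ?U" for z
      using N1[OF a] aU y(1) that by (metis One_nat_def card_le_Suc0_iff_eq subsetD)
    then show ?thesis
      using that[of 2] y(2) by (metis insertCI numeral_eq_one_iff semiring_norm(85))
  next
    case False
    then show ?thesis
      using that[of 1] by auto
  qed
  \<comment> \<open>\<open>b\<close> must not be adjacent to \<open>a\<close>. Of the four other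
    neighbours of \<open>v\<close>, at most one is adjacent to \<open>a\<close>.\<close>
  have "card (?N - {a} - nbrs a ?Z) > 0"
  proof -
    have "card (?N - {a}) - card (nbrs a ?Z) \<le> card (?N - {a} - nbrs a ?Z)"
      using aU(1) by (rule diff_card_le_card_Diff)
    then show ?thesis
      using N1[OF a] a v(2) by (simp add: card_Diff_singleton)
  qed
  then obtain b where b: "b \<in> ?N" "b \<noteq> a" "b \<notin> nbrs a ?Z"
    by (metis DiffE all_not_in_conv card.empty less_irrefl singletonI)
  have bZ: "b \<in> ?Z"
    using b(1) vN by (auto simp: nbrs_def)
  then have nab: "{a, b} \<notin> E"
    using b(3) by (auto simp: nbrs_def)
  let ?S = "{v, a, b}" and ?T = "?N - {a, b}"
  define h where "h x = (if x \<in> ?S then c else if x \<in> ?T then 3 - c else f x)" for x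
  have NW: "?N \<subseteq> W"
    by (auto simp: nbrs_def)
  have cne: "3 - c \<noteq> c"
    using c(1) by auto
  have cls1: "{x \<in> W. h x = c} = {x \<in> ?U. f x = c} \<union> ?S"
    using a b(1) v(1) NW cne by (auto simp: h_def split: if_splits)
  have cls2: "{x \<in> W. h x = 3 - c} = {x \<in> ?U. f x = 3 - c} \<union> ?T"
    using a b(1) v(1) vN NW cne by (auto simp: h_def split: if_splits)
  have "v \<noteq> a" "v \<noteq> b"
    using a b(1) vN by metis+
  then have "card ?S = 3"
    using b(2) by simp
  moreover have "{x \<in> ?U. f x = c} \<inter> ?S = {}"
    using a b(1) by auto
  ultimately have card1: "card {x \<in> W. h x = c} = card {x \<in> ?U. f x = c} + 3"
    unfolding cls1 using fin by (subst card_Un_disjoint) auto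
  have "card ?T = 3"
    using a b v(2) fin by (subst card_Diff_subset) auto
  then have card2: "card {x \<in> W. h x = 3 - c} = card {x \<in> ?U. f x = 3 - c} + 3"
    unfolding cls2 using fin by (subst card_Un_disjoint) auto
  have cc: "{1..2} = {c, 3 - c}"
    using c(1) by auto
  have forestU: "induces_forest {x \<in> ?U. f x = i}" if "i \<in> {c, 3 - c}" for i
    using f that unfolding equitable_forests_def cc by blast
  \<comment> \<open>Without \<open>v\<close>, each of the three neighbours in \<open>?T\<close> has
    at most one neighbour left.\<close>
  have for2: "induces_forest {x \<in> W. h x = 3 - c}"
    unfolding cls2
  proof (rule induces_forest_Un[of _ _ ?Z])
    show "{x \<in> ?U. f x = 3 - c} \<union> ?T \<subseteq> ?Z"
      using vN NW by auto
  qed (use fin forestU N1 in auto)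
  have for1: "induces_forest {x \<in> W. h x = c}"
  proof -
    let ?A = "{x \<in> ?U. f x = c}"
    have finA: "finite ?A"
      using fin by auto
    \<comment> \<open>The order \<open>b\<close>, \<open>v\<close>, \<open>a\<close> matters.
      \<open>b\<close> has at most one neighbour besides \<open>v\<close>; the only neighbour of
      \<open>v\<close> present is then \<open>b\<close>, all others being outside \<open>?U\<close>;
      the only one of \<open>a\<close> is \<open>v\<close>, by the choice of \<open>b\<close> and
      \<open>c\<close>.\<close>
    have "card (nbrs b ?A) \<le> card (nbrs b ?Z)"
      using fin by (intro card_nbrs_mono) auto
    then have "induces_forest (insert b ?A)"
      using forestU N1[OF b(1)] finA by (intro induces_forest_insert) auto
    moreover have "nbrs v (insert b ?A) \<subseteq> {b}"
      by (auto simp: nbrs_def)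
    then have "card (nbrs v (insert b ?A)) \<le> 1"
      by (metis card.empty card_insert_if card_mono finite.emptyI finite.insertI One_nat_def empty_iff)
    ultimately have "induces_forest (insert v (insert b ?A))"
      using finA by (simp add: induces_forest_insert del: One_nat_def)
    moreover have "nbrs a (insert v (insert b ?A)) \<subseteq> {v}"
      using nab c(2) by (auto simp: nbrs_def)
    then have "card (nbrs a (insert v (insert b ?A))) \<le> 1"
      by (metis card.empty card_insert_if card_mono finite.emptyI finite.insertI One_nat_def empty_iff)
    ultimately have "induces_forest (insert a (insert v (insert b ?A)))"
      using finA by (simp add: induces_forest_insert del: One_nat_def)
    moreover have "insert a (insert v (insert b ?A)) = ?A \<union> ?S"
      by auto
    ultimately show ?thesis
      unfolding cls1 by simp
  qed
  have "h ` W \<subseteq> {1..2}"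
  proof
    fix i assume "i \<in> h ` W"
    then obtain x where x: "x \<in> W" "i = h x"
      by blast
    have "f x \<in> {1..2}" if "x \<in> ?U"
      using f that unfolding equitable_forests_def by blast
    then show "i \<in> {1..2}"
      using x c(1) by (auto simp: h_def)
  qed
  moreover have "card {x \<in> ?U. f x = i} \<le> card {x \<in> ?U. f x = j} + 1" if "i \<in> {c, 3 - c}" "j \<in> {c, 3 - c}" for i j
    using f that unfolding equitable_forests_def cc by blast
  ultimately have "equitable_forests W 2 h"
    using card1 card2 for1 for2 unfolding equitable_forests_def cc by auto
  then show ?thesis
    by blast
qed

theorem exists_equitable_forests:
  assumes "2 \<le> t" "W \<subseteq> V"
  shows "\<exists>f. equitable_forests W t f"
  using assms(2)
proof (induction "card W" arbitrary: W rule: less_induct)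
  case less
  have finW: "finite W"
    using less.prems finite_V finite_subset by blast
  show ?case
  proof (cases "card W \<le> t")
    case True
    then show ?thesis
      using equitable_forests_small finW by blast
  next
    case False
    then have tW: "t \<le> card W"
      by simp
    have ne: "W \<noteq> {}"
      using False by auto
    have extend: ?thesis if ys: "set ys \<subseteq> W" "distinct ys" "ys \<noteq> []" "length ys \<le> t"
      "ordered_for (W - set ys) ys" for ys
    proof -
      obtain xs where xs: "set xs \<subseteq> W" "distinct xs" "length xs = t" "ordered_for (W - set xs) xs"
        using ordered_for_extend[OF less.prems tW ys] .
      have "W - set xs \<subset> W"
        using xs assms(1) by (cases xs) auto
      then have "card (W - set xs) < card W"
        using finW by (rule psubset_card_mono[rotated])
      then obtain f where "equitable_forests (W - set xs) t f"
        using less.hyps[of "W - set xs"] less.prems by blast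
      then show ?thesis
        using equitable_forests_extend[OF less.prems xs] by blast
    qed
    have drop: "card (nbrs x (W - B)) + card (nbrs x W \<inter> B) = card (nbrs x W)" for x B
    proof -
      have "nbrs x (W - B) = nbrs x W - B"
        by (auto simp: nbrs_def)
      then show ?thesis
        using finW finite_nbrs[of W x] by (metis card_Diff_subset_Int card_mono finite_Int inf_le1 le_add_diff_inverse2)
    qed
    show ?thesis
    proof (rule reducible_configuration[OF less.prems ne])
      fix x assume x: "x \<in> W" "card (nbrs x W) \<le> 1"
      have "card (nbrs x (W - {x})) \<le> card (nbrs x W)"
        using finW by (intro card_nbrs_mono) auto
      then show ?thesis
        using x assms(1) by (intro extend[of "[x]"]) auto
    next
      fix x y assume xy: "x \<in> W" "y \<in> W" "{x, y} \<in> E" "card (nbrs x W) = 2" "card (nbrs y W) \<le> 4"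
      have "x \<noteq> y"
        using xy(3) no_loop by metis
      have "y \<in> nbrs x W \<inter> {x, y}" "x \<in> nbrs y W \<inter> {x, y}"
        using xy edge_sym[of x y] by (simp_all add: nbrs_def)
      then have "card (nbrs x W \<inter> {x, y}) > 0" "card (nbrs y W \<inter> {x, y}) > 0"
        by (auto simp: card_gt_0_iff)
      \<comment> \<open>Deleting both vertices removes the edge between them. The remaining 3 and 1
        are just the bounds for \<open>[y, x]\<close>, so the vertex of degree 2 comes last.\<close>
      then have "card (nbrs x (W - {x, y})) \<le> 1" "card (nbrs y (W - {x, y})) \<le> 3"
        using drop[of x "{x, y}"] drop[of y "{x, y}"] xy by linarith+
      then show ?thesis
        using xy assms(1) \<open>x \<noteq> y\<close> by (intro extend[of "[y, x]"]) (auto simp: insert_commute)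
    next
      fix v assume v: "v \<in> W" "card (nbrs v W) = 5" "\<And>w. w \<in> nbrs v W \<Longrightarrow> card (nbrs w W) = 2"
      \<comment> \<open>In \<open>[v, a, b]\<close> the bound in front is 5, enough for
        \<open>v\<close>, but three colours are needed. With two colours, deleting \<open>v\<close>
        and one neighbour leaves \<open>v\<close> with 4 neighbours where 3 are allowed; hence all
        six vertices are deleted at once.\<close>
      show ?thesis
      proof (cases "t = 2")
        case True
        have "W - insert v (nbrs v W) \<subset> W"
          using v(1) by auto
        then have "card (W - insert v (nbrs v W)) < card W"
          using finW by (rule psubset_card_mono[rotated])
        then obtain f where "equitable_forests (W - insert v (nbrs v W)) t f"
          using less.hyps[of "W - insert v (nbrs v W)"] less.prems by blast
        then show ?thesis
          using equitable_forests_extend_star[OF less.prems v] True by blast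
      next
        case False
        have "\<not> card (nbrs v W) \<le> Suc 0"
          using v(2) by simp
        then obtain a b where ab: "a \<in> nbrs v W" "b \<in> nbrs v W" "a \<noteq> b"
          unfolding card_le_Suc0_iff_eq[OF finite_nbrs[OF finW]] by blast
        let ?B = "{v, a, b}"
        have vn: "v \<noteq> a" "v \<noteq> b"
          using ab no_loop[of v] by (auto simp: nbrs_def)
        have "v \<in> nbrs a W \<inter> ?B" "v \<in> nbrs b W \<inter> ?B" "nbrs v W \<inter> ?B \<supseteq> {a, b}"
          using ab v(1) edge_sym[of v a] edge_sym[of v b] by (simp_all add: nbrs_def)
        then have "card (nbrs a W \<inter> ?B) > 0" "card (nbrs b W \<inter> ?B) > 0"
          by (auto simp: card_gt_0_iff)
        then have "card (nbrs a (W - ?B)) \<le> 1" "card (nbrs b (W - ?B)) \<le> 1"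
          using drop[of a ?B] drop[of b ?B] v(3)[OF ab(1)] v(3)[OF ab(2)] by linarith+
        moreover have "card (nbrs v (W - ?B)) \<le> 5"
          using drop[of v ?B] v(2) by linarith
        ultimately show ?thesis
          using v(1) ab vn False assms(1) by (intro extend[of "[v, a, b]"]) (auto simp: nbrs_def)
      qed
    qed
  qed
qed

end

subsection \<open>Planar graphs of girth at least 6\<close>

lemma uedges_induce: "uedges (G \<restriction> A) = {e \<in> uedges G. e \<subseteq> A}"
  by (auto simp: uedges_def)

lemma path_edges_awalk_verts:
  assumes "pre_digraph.cas G u p v" "set p \<subseteq> arcs G"
  shows "hd (pre_digraph.awalk_verts G u p) = u \<and> last (pre_digraph.awalk_verts G u p) = v \<and>
    path_edges (pre_digraph.awalk_verts G u p) \<subseteq> uedges G"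
  using assms
proof (induction p arbitrary: u)
  case Nil
  then show ?case by (simp add: pre_digraph.awalk_verts.simps pre_digraph.cas.simps)
next
  case (Cons a p)
  have "last (pre_digraph.awalk_verts G (head G a) p) = v"
    "path_edges (pre_digraph.awalk_verts G (head G a) p) \<subseteq> uedges G"
    using Cons by (simp_all add: pre_digraph.cas.simps)
  moreover have "{tail G a, head G a} \<in> uedges G"
    using Cons.prems(2) by (auto simp: uedges_def)
  moreover obtain ys where "pre_digraph.awalk_verts G (head G a) p = head G a # ys"
    using Cons.prems(1) by (cases p) (auto simp: pre_digraph.awalk_verts.simps pre_digraph.cas.simps)
  ultimately show ?case
    using Cons.prems(1) by (simp add: pre_digraph.awalk_verts.simps pre_digraph.cas.simps)
qed

text \<open>The first arc of a cycle serves as closing edge: the rest of the walk visits distinct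
  vertices, at least three, so it joins the ends of that edge without using it.\<close>

lemma uforest_if_edge_acyclic:
  assumes "edge_acyclic (uedges G)"
  shows "uforest G"
  unfolding uforest_def
proof
  assume "\<exists>p. ucycle G p"
  then obtain p u where p: "pre_digraph.awalk G u p u" "distinct (tl (pre_digraph.awalk_verts G u p))"
    "3 \<le> length p"
    by (auto simp: ucycle_def pre_digraph.cycle_def)
  then obtain a q where aq: "p = a # q"
    by (cases p) auto
  let ?w = "head G a"
  let ?xs = "pre_digraph.awalk_verts G ?w q"
  have cas: "tail G a = u" "pre_digraph.cas G ?w q u" "set q \<subseteq> arcs G" "a \<in> arcs G"
    using p(1) aq by (auto simp: pre_digraph.awalk_def pre_digraph.cas.simps)
  have xs: "distinct ?xs" "3 \<le> length ?xs"
    using p(2,3) aq by (auto simp: pre_digraph.awalk_verts.simps pre_digraph.length_awalk_verts)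
  have ends: "hd ?xs = ?w" "last ?xs = u"
    using path_edges_awalk_verts[OF cas(2,3)] by auto
  have edge: "{?w, u} \<in> uedges G"
    using cas(1,4) by (auto simp: uedges_def)
  have "path_edges ?xs \<subseteq> uedges G - {{?w, u}}"
    using path_edges_awalk_verts[OF cas(2,3)] closing_edge_notin_path_edges[OF xs] ends by auto
  then have "uconn (uedges G - {{?w, u}}) ?w u"
    using uconn_path_edges[of ?xs] xs(2) ends by fastforce
  then show False
    using assms edge unfolding edge_acyclic_def by metis
qed

context graph
begin

lemma finite_uedges: "finite (uedges G)"
  by (simp add: uedges_def)

lemma card_uedge: "e \<in> uedges G \<Longrightarrow> card e = 2"
  using no_loops by (auto simp: uedges_def)

lemma uedges_subset_verts: "\<Union>(uedges G) \<subseteq> verts G"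
  by (auto simp: uedges_def)

lemma uedge_arcE:
  assumes "{x, y} \<in> uedges G"
  obtains a where "a \<in> arcs G" "tail G a = x" "head G a = y"
proof -
  obtain a where a: "a \<in> arcs G" "{x, y} = {tail G a, head G a}"
    using assms by (auto simp: uedges_def)
  then consider "tail G a = x" "head G a = y" | "tail G a = y" "head G a = x"
    by (metis doubleton_eq_iff)
  then show ?thesis
  proof cases
    case 1
    then show ?thesis using that a(1) by blast
  next
    case 2
    then have "(y, x) \<in> arcs_ends G"
      using a(1) by (force simp: arcs_ends_def arc_to_ends_def)
    then have "(x, y) \<in> arcs_ends G"
      using sym_arcs by (simp add: symmetric_def sym_def)
    then show ?thesis
      using that by (auto simp: arcs_ends_def arc_to_ends_def)
  qed
qed

lemma awalk_of_path_edges: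
  assumes "xs \<noteq> []" "hd xs \<in> verts G" "path_edges xs \<subseteq> uedges G"
  shows "\<exists>p. awalk (hd xs) p (last xs) \<and> awalk_verts (hd xs) p = xs"
  using assms
proof (induction xs rule: path_edges.induct)
  case (1 x y zs)
  obtain a where a: "a \<in> arcs G" "tail G a = x" "head G a = y"
    using uedge_arcE[of x y] 1(4) by auto
  then have "y \<in> verts G"
    by auto
  then obtain p where "awalk y p (last (y # zs))" "awalk_verts y p = y # zs"
    using 1 by auto
  then show ?case
    using a by (intro exI[of _ "a # p"]) (auto simp: awalk_Cons_iff)
next
  case ("2_2" x)
  then show ?case
    by (intro exI[of _ "[]"]) (auto simp: awalk_Nil_iff)
qed auto

text \<open>An edge \<open>{u, v}\<close> of \<open>F\<close> that is not a bridge is closed up by a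
  path in the rest of \<open>F\<close>. This path cannot be \<open>[u, v]\<close>, so the cycle has
  length at least 3, and its edges are distinct members of \<open>F\<close>.\<close>

lemma girth_le_card_edges:
  assumes "F \<subseteq> uedges G" "\<not> edge_acyclic F"
  shows "girth G \<le> enat (card F)"
proof -
  obtain u v where uv: "{u, v} \<in> F" "uconn (F - {{u, v}}) u v"
    using assms(2) by (auto simp: edge_acyclic_def)
  then obtain xs where xs: "xs \<noteq> []" "hd xs = u" "last xs = v" "distinct xs"
    "path_edges xs \<subseteq> F - {{u, v}}"
    using uconn_imp_distinct_path by metis
  have uvG: "{u, v} \<in> uedges G"
    using uv(1) assms(1) by (rule subsetD[rotated])
  then have "u \<noteq> v" "u \<in> verts G"
    using card_uedge[of "{u, v}"] uedges_subset_verts by auto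
  have "3 \<le> length xs"
  proof (rule ccontr)
    assume "\<not> 3 \<le> length xs"
    moreover have "length xs \<noteq> 0" "length xs \<noteq> 1"
      using xs(1-3) \<open>u \<noteq> v\<close> by (auto simp: length_Suc_conv)
    ultimately have "length xs = 2"
      by linarith
    then have "xs = [u, v]"
      using xs(2,3) by (auto simp: length_Suc_conv numeral_2_eq_2)
    then show False
      using xs(5) by simp
  qed
  obtain p where p: "awalk u p v" "awalk_verts u p = xs"
    using awalk_of_path_edges[of xs] xs \<open>u \<in> verts G\<close> assms(1) by auto
  obtain a where a: "a \<in> arcs G" "tail G a = v" "head G a = u"
    using uedge_arcE[of v u] uvG by (metis insert_commute)
  have "awalk v [a] u"
    using a by (auto simp: awalk_Cons_iff awalk_Nil_iff)
  then have walk: "awalk u (p @ [a]) u"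
    using p(1) by simp
  have "awalk_verts u (p @ [a]) = xs @ [u]"
    using p a awalk_verts_append[OF walk] by auto
  moreover have "distinct (tl xs @ [u])"
    using xs(1,2,4) by (cases xs) auto
  ultimately have "cycle (p @ [a])"
    using walk xs(1) unfolding cycle_def by (intro exI[of _ u]) (auto simp: tl_append2)
  moreover have len: "length (p @ [a]) = length xs"
    using p(2) length_awalk_verts[of u p] by simp
  ultimately have "ucycle G (p @ [a])"
    using \<open>3 \<le> length xs\<close> by (simp add: ucycle_def)
  then have "girth G \<le> enat (length xs)"
    unfolding girth_def using len by (intro INF_lower2[of "p @ [a]"]) auto
  moreover have "length xs \<le> card F"
  proof -
    have "card (insert {u, v} (path_edges xs)) = length xs"
      using card_path_edges[OF xs(4)] xs(1,5) by (subst card_insert_disjoint) auto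
    moreover have "insert {u, v} (path_edges xs) \<subseteq> F"
      using uv(1) xs(5) by (metis Diff_subset insert_subset order_trans)
    ultimately show ?thesis
      using card_mono[OF finite_subset[OF assms(1) finite_uedges]] by metis
  qed
  ultimately show ?thesis
    using order_trans by fastforce
qed

end

lemma plane_drawing_plane_edges:
  assumes "graph G" "plane_drawing G pos \<gamma>"
  shows "plane_edges (uedges G) pos \<gamma>"
proof -
  interpret graph G by fact
  have inner: "path_image (\<gamma> e) \<inter> path_image (\<gamma> e') \<subseteq> pos ` e"
    if "e \<in> uedges G" "e' \<in> uedges G" "e \<noteq> e'" for e e'
    using assms(2) that unfolding plane_drawing_def by fast
  show ?thesis
    by unfold_locales
      (use assms(2) inner in \<open>auto simp: plane_drawing_def finite_uedges card_uedge
        intro: inj_on_subset[OF _ uedges_subset_verts] simp del: Union_iff\<close>)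
qed

lemma planar_girth_6_sparse:
  assumes "graph G" "planar G" "6 \<le> girth G"
  shows "sparse_edges (verts G) (uedges G)"
proof -
  interpret graph G by fact
  obtain pos \<gamma> where "plane_drawing G pos \<gamma>"
    using assms(2) by (auto simp: planar_def)
  then interpret P: plane_edges "uedges G" pos \<gamma>
    using plane_drawing_plane_edges assms(1) by blast
  show ?thesis
  proof
    fix W assume W: "W \<subseteq> verts G" "W \<noteq> {}"
    show "2 * card {e \<in> uedges G. e \<subseteq> W} < 3 * card W"
    proof (rule plane_edges_sparse)
      show "plane_edges {e \<in> uedges G. e \<subseteq> W} pos \<gamma>"
        by (rule P.plane_edges_subset) auto
      fix F assume F: "F \<subseteq> {e \<in> uedges G. e \<subseteq> W}" "\<not> edge_acyclic F"
      then have "girth G \<le> enat (card F)"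
        by (intro girth_le_card_edges) auto
      then have "6 \<le> enat (card F)"
        using assms(3) order_trans by blast
      then show "6 \<le> card F"
        by (simp add: numeral_eq_enat)
    qed (use W in \<open>auto intro: finite_subset\<close>)
  qed (auto simp: card_uedge)
qed

text \<open>With one colour the only class is the whole vertex set, and inducing on it gives back
  \<open>G\<close>. This decides between the values 1 and 2 of \<open>va_equiv\<close>.\<close>

lemma equitable_tree_coloring_1_iff:
  assumes "wf_digraph G"
  shows "(\<exists>f. equitable_tree_coloring G 1 f) \<longleftrightarrow> uforest G"
proof -
  have eq: "G \<restriction> verts G = G"
    using assms by (intro pre_digraph.equality) (auto simp: wf_digraph_def)
  show ?thesis
  proof
    assume "\<exists>f. equitable_tree_coloring G 1 f"
    then obtain f where f: "equitable_tree_coloring G 1 f"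
      by blast
    then have "color_class G f 1 = verts G"
      by (auto simp: equitable_tree_coloring_def equitable_coloring_def coloring_def color_class_def)
    then show "uforest G"
      using f eq by (auto simp: equitable_tree_coloring_def)
  next
    assume "uforest G"
    then have "equitable_tree_coloring G 1 (\<lambda>_. 1)"
      using eq by (auto simp: equitable_tree_coloring_def equitable_coloring_def coloring_def color_class_def)
    then show "\<exists>f. equitable_tree_coloring G 1 f"
      by blast
  qed
qed

theorem theorem3p8:
  fixes G :: "('a, 'b) pre_digraph"
  assumes "graph G" and "planar G" and "6 \<le> girth G"
  shows "(\<forall>t\<ge>2. \<exists>f. equitable_tree_coloring G t f) \<and>
         (\<not> uforest G \<longrightarrow> va_equiv G = 2) \<and>
         (uforest G \<longrightarrow> va_equiv G = 1)"
proof -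
  interpret graph G by fact
  interpret sparse_edges "verts G" "uedges G"
    using planar_girth_6_sparse assms .
  have ge2: "\<exists>f. equitable_tree_coloring G t f" if t: "t \<ge> 2" for t
  proof -
    obtain f where f: "equitable_forests (verts G) t f"
      using exists_equitable_forests[OF t] by blast
    have "uforest (G \<restriction> color_class G f i)" if "i \<in> {1..t}" for i
      using f that unfolding equitable_forests_def induces_forest_def
      by (intro uforest_if_edge_acyclic) (simp add: uedges_induce color_class_def)
    moreover have "\<bar>int (card (color_class G f i)) - int (card (color_class G f j))\<bar> \<le> 1"
      if "i \<in> {1..t}" "j \<in> {1..t}" for i j
    proof -
      have "card (color_class G f i) \<le> card (color_class G f j) + 1"
        "card (color_class G f j) \<le> card (color_class G f i) + 1"
        using f that unfolding equitable_forests_def color_class_def by blast+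
      then show ?thesis
        by linarith
    qed
    ultimately have "equitable_tree_coloring G t f"
      using f by (auto simp: equitable_tree_coloring_def equitable_coloring_def coloring_def
          equitable_forests_def)
    then show ?thesis
      by blast
  qed
  note one = equitable_tree_coloring_1_iff[OF wf_digraph]
  have "va_equiv G = 2" if nf: "\<not> uforest G"
    unfolding va_equiv_def
  proof (rule Least_equality)
    fix t assume t: "1 \<le> t \<and> (\<forall>t'\<ge>t. \<exists>f. equitable_tree_coloring G t' f)"
    then have "t \<noteq> 1"
      using one nf by blast
    then show "2 \<le> t"
      using t by linarith
  qed (use ge2 in auto)
  moreover have "va_equiv G = 1" if "uforest G"
    unfolding va_equiv_def
  proof (rule Least_equality)
    have "\<exists>f. equitable_tree_coloring G t f" if "1 \<le> t" for t
      using one \<open>uforest G\<close> ge2[of t] that by (cases "t = 1") auto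
    then show "1 \<le> (1::nat) \<and> (\<forall>t'\<ge>1. \<exists>f. equitable_tree_coloring G t' f)"
      by blast
  qed auto
  ultimately show ?thesis
    using ge2 by blast
qed

end
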